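(* Let $Q>0$, let $Z=(Z,d,\mu)$ be an Ahlfors $Q$-regular compact metric measure space with $\operatorname{diam}(Z)=1$, and let $p>1$. Then the space $\dot A^p(Z)$ is independent of the hyperbolic filling, with comparability of semi-norms for different fillings. That is, if $X=(V,E)$ and $X'=(V',E')$ are two hyperbolic fillings of $Z$ (constructed from possibly different maximal $2^{-n}$-separated sets), with associated Poisson extension operators $P$ and $P'$, then for $f\in L^1(Z)$ one has $d(Pf)\in\ell^{p,\infty}(E)$ if and only if $d(P'f)\in\ell^{p,\infty}(E')$, and there is a constant $C\ge1$ independent of $f$ with $C^{-1}\|d(Pf)\|_{\ell^{p,\infty}}\le\|d(P'f)\|_{\ell^{p,\infty}}\le C\|d(Pf)\|_{\ell^{p,\infty}}$.
   Context: Ahlfors regularity: a metric space $(Z,d)$ with a Borel measure $\mu$ is Ahlfors $Q$-regular (with $\operatorname{diam}(Z)=1$) if there is a constant $c\ge 1$ with $c^{-1}r^Q\le\mu(B)\le c\,r^Q$ for every open ball $B$ of radius $0<r\le 1$. Write $|A|=\mu(A)$. Hyperbolic filling: for each $n\in\mathbb{N}=\{1,2,\dots\}$ choose a maximal $2^{-n}$-separated set $Z_n\subset Z$. Let $V_n$ be the collection of balls $B(z,2^{1-n})$, $z\in Z_n$ (level $n$), and $V_0=\{Z\}$ (level $0$). The vertex set $V$ is the disjoint union of the $V_n$, $n\ge 0$. Two distinct vertices $B,B'$ are joined by an (unoriented, unique) edge if their levels differ by at most $1$ and $B\cap B'\ne\emptyset$; $E$ is the set of edges. For each edge $e$ one fixes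 a choice of initial vertex $e_-$ and terminal vertex $e_+$ among its two endpoints. The graph $X=(V,E)$ is a hyperbolic filling of $Z$; it depends on the choice of the sets $Z_n$. Poisson extension: for $f\in L^1(Z)$ (real-valued), $Pf\colon V\to\mathbb{R}$ is $Pf(B)=\frac1{|B|}\int_B f\,d\mu$. Gradient: for $u\colon V\to\mathbb{R}$, $du\colon E\to\mathbb{R}$ is $du(e)=u(e_+)-u(e_-)$. (Analogously for $X'$.) Weak $\ell^p$: for a countable set $M$ and $p>1$, $\ell^{p,\infty}(M)$ is the space of all $s\colon M\to\mathbb{R}$ for which there is $C\ge0$ with $\#\{m\in M:|s(m)|>\lambda\}\le (C/\lambda)^p$ for all $\lambda>0$, with norm $\|s\|_{\ell^{p,\infty}}=\sup\{n^{-1+1/p}\sum_{j\in F}|s(j)|: n\in\mathbb{N},\ F\subset M,\ \#F=n\}$ (equal to $+\infty$ for $s\notin\ell^{p,\infty}(M)$). $\dot A^p(Z)$ (with respect to $X$) is the space of all $f\in L^1(Z)$ with $d(Pf)\in\ell^{p,\infty}(E)$, with semi-norm $\|f\|_{\dot A^p}=\|d(Pf)\|_{\ell^{p,\infty}}$. *)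

theory Defs
  imports "HOL-Analysis.Analysis"
begin

text \<open>
  The space is a subset \<open>Z\<close> of a metric type, with a measure \<open>M\<close> on the Borel sets of \<open>Z\<close>
  (so that \<open>space M = Z\<close>). Open balls of \<open>Z\<close> are the traces on \<open>Z\<close> of the balls of the type.
\<close>

definition zball :: "'a::metric_space set \<Rightarrow> 'a \<Rightarrow> real \<Rightarrow> 'a set" where
  "zball Z z r = ball z r \<inter> Z"

definition ahlfors_regular :: "real \<Rightarrow> 'a::metric_space set \<Rightarrow> 'a measure \<Rightarrow> bool" where
  "ahlfors_regular Q Z M \<longleftrightarrow>
     sets M = sets (restrict_space borel Z) \<and>
     (\<exists>c::real. c \<ge> 1 \<and> (\<forall>z\<in>Z. \<forall>r. 0 < r \<and> r \<le> 1 \<longrightarrow>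
        ennreal (inverse c * r powr Q) \<le> emeasure M (zball Z z r) \<and>
        emeasure M (zball Z z r) \<le> ennreal (c * r powr Q)))"

definition separated_set :: "real \<Rightarrow> 'a::metric_space set \<Rightarrow> bool" where
  "separated_set \<epsilon> A \<longleftrightarrow> (\<forall>x\<in>A. \<forall>y\<in>A. x \<noteq> y \<longrightarrow> \<epsilon> \<le> dist x y)"

definition maximal_separated :: "real \<Rightarrow> 'a::metric_space set \<Rightarrow> 'a set \<Rightarrow> bool" where
  "maximal_separated \<epsilon> Z A \<longleftrightarrow> A \<subseteq> Z \<and> separated_set \<epsilon> A \<and>
     (\<forall>B. A \<subseteq> B \<and> B \<subseteq> Z \<and> separated_set \<epsilon> B \<longrightarrow> B = A)"

text \<open>
  A vertex is a pair (level, ball), the ball being a set of points; the level makes the union of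
  the collections \<open>V\<^sub>n\<close> disjoint. An edge is the two-element set of its endpoints.
\<close>

type_synonym 'a vertex = "nat \<times> 'a set"
type_synonym 'a edge = "'a vertex set"

text \<open>
  All the choices that determine a hyperbolic filling: the sets \<open>Z\<^sub>n\<close> for \<open>n \<ge> 1\<close> (the value of
  \<open>centers\<close> at 0 is not used) and the initial and terminal vertex of every edge.
\<close>

record 'a filling =
  centers :: "nat \<Rightarrow> 'a set"
  initial :: "'a edge \<Rightarrow> 'a vertex"
  terminal :: "'a edge \<Rightarrow> 'a vertex"

definition level_balls :: "'a::metric_space set \<Rightarrow> 'a filling \<Rightarrow> nat \<Rightarrow> 'a set set" where
  "level_balls Z X n =
     (if n = 0 then {Z} else (\<lambda>z. zball Z z (2 powr (1 - real n))) ` centers X n)"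

definition vertices :: "'a::metric_space set \<Rightarrow> 'a filling \<Rightarrow> 'a vertex set" where
  "vertices Z X = (SIGMA n:UNIV. level_balls Z X n)"

definition edges :: "'a::metric_space set \<Rightarrow> 'a filling \<Rightarrow> 'a edge set" where
  "edges Z X = {{v, w} | v w. v \<in> vertices Z X \<and> w \<in> vertices Z X \<and> v \<noteq> w \<and>
     \<bar>int (fst v) - int (fst w)\<bar> \<le> 1 \<and> snd v \<inter> snd w \<noteq> {}}"

definition hyperbolic_filling :: "'a::metric_space set \<Rightarrow> 'a filling \<Rightarrow> bool" where
  "hyperbolic_filling Z X \<longleftrightarrow>
     (\<forall>n\<ge>1. maximal_separated (2 powr (- real n)) Z (centers X n)) \<and>
     (\<forall>e\<in>edges Z X. e = {initial X e, terminal X e})"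

definition poisson_ext :: "'a measure \<Rightarrow> ('a \<Rightarrow> real) \<Rightarrow> 'a vertex \<Rightarrow> real" where
  "poisson_ext M f v = 1 / measure M (snd v) * set_lebesgue_integral M (snd v) f"

definition gradient :: "'a filling \<Rightarrow> ('a vertex \<Rightarrow> real) \<Rightarrow> 'a edge \<Rightarrow> real" where
  "gradient X u e = u (terminal X e) - u (initial X e)"

text \<open>
  Functions on an index set \<open>I\<close> are functions on the whole type; only their values on \<open>I\<close> matter.
  The explicit finiteness excludes that an infinite superlevel set has \<open>card\<close> 0.
\<close>

definition weak_lp :: "real \<Rightarrow> 'i set \<Rightarrow> ('i \<Rightarrow> real) set" where
  "weak_lp p I = {s. \<exists>C\<ge>0. \<forall>t>0.
     finite {i\<in>I. \<bar>s i\<bar> > t} \<and> real (card {i\<in>I. \<bar>s i\<bar> > t}) \<le> (C / t) powr p}"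

definition weak_lp_norm :: "real \<Rightarrow> 'i set \<Rightarrow> ('i \<Rightarrow> real) \<Rightarrow> ennreal" where
  "weak_lp_norm p I s =
     (if s \<in> weak_lp p I
      then Sup {ennreal (real n powr (- 1 + 1 / p) * (\<Sum>j\<in>F. \<bar>s j\<bar>)) | n F.
                  n \<ge> 1 \<and> F \<subseteq> I \<and> finite F \<and> card F = n}
      else \<infinity>)"

definition A_space :: "real \<Rightarrow> 'a::metric_space set \<Rightarrow> 'a measure \<Rightarrow> 'a filling \<Rightarrow> ('a \<Rightarrow> real) set" where
  "A_space p Z M X =
     {f. integrable M f \<and> gradient X (poisson_ext M f) \<in> weak_lp p (edges Z X)}"

definition A_seminorm :: "real \<Rightarrow> 'a::metric_space set \<Rightarrow> 'a measure \<Rightarrow> 'a filling \<Rightarrow> ('a \<Rightarrow> real) \<Rightarrow> ennreal" where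
  "A_seminorm p Z M X f = weak_lp_norm p (edges Z X) (gradient X (poisson_ext M f))"

end

theory Submission
  imports Defs
begin

text \<open>
  Everything reduces to sums over finite sets. For \<open>p > 1\<close> a function
  \<open>s\<close> lies in weak \<open>\<ell>\<^sup>p\<close> exactly if, for some
  \<open>B\<close>, every finite \<open>F\<close> satisfies \<open>(\<Sum>j\<in>F. \<bar>s
  j\<bar>) \<le> B * (card F) powr (1 - 1/p)\<close>; the least such \<open>B \<ge> 0\<close> is
  the norm. So it suffices to bound the sum of \<open>\<bar>d(P'f)\<bar>\<close> over a finite set
  \<open>F\<close> of edges of the second filling \<open>X'\<close> by sums of
  \<open>\<bar>d(Pf)\<bar>\<close> over finite sets of edges of \<open>X\<close>.

  Let \<open>e'\<close> be an edge of \<open>X'\<close>. A few levels above it there is a ball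
  \<open>D\<close> of \<open>X\<close>, of level \<open>i\<close> say, that contains both
  endpoints of \<open>e'\<close>. For every \<open>x\<close> in \<open>D\<close> there is a chain
  of balls of \<open>X\<close> that starts with \<open>D\<close> and has one ball containing
  \<open>x\<close> on each further level; consecutive balls of the chain are joined by an edge.
  Hence \<open>\<bar>f x - Pf(D)\<bar>\<close> is at most the sum of
  \<open>\<bar>d(Pf)\<bar>\<close> over the edges between consecutive levels whose two balls
  contain \<open>x\<close>, plus the deviation of \<open>f x\<close> from the averages of
  \<open>f\<close> at the end of the chain. Integration over an endpoint of \<open>e'\<close>
  gives
  \<open>\<bar>d(P'f)(e')\<bar> \<le> o(1) + C * (\<Sum>j. t^j * \<Sum>{\<bar>d(Pf)(e)\<bar> | e between levels i+j and i+j+1 meeting D})\<close>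
  with \<open>t = 2 powr (-Q)\<close>, the ratio, up to constants, of the measures of balls of
  consecutive levels. The term \<open>o(1)\<close> tends to \<open>0\<close> with the length of
  the chain, because balls of one level have bounded overlap and continuous functions are dense in
  \<open>L\<^sup>1\<close>.

  Now sum over \<open>e' \<in> F\<close>, with \<open>n = card F\<close>. By packing, only
  \<open>O(n * t powr (-j))\<close> edges of \<open>X\<close> occur for a given \<open>j\<close>,
  and each of them for a bounded number of \<open>e'\<close>. Thus the \<open>j\<close>-th term is
  at most \<open>C * t^j * B * (n * t powr (-j)) powr (1 - 1/p) = C * B * n powr (1 - 1/p) * (t
  powr (1/p))^j\<close>, which is summable over \<open>j\<close>. The constant depends only on the
  space and \<open>p\<close>, and the two fillings play symmetric roles.
\<close>

section \<open>Weak Lebesgue sequence spaces through sums over finite sets\<close>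

text \<open>
  The sum of the \<open>n\<close> largest values of \<open>\<bar>s\<bar>\<close> grows at most like \<open>n powr (1 - 1/p)\<close>. Unlike the
  condition on superlevel sets, this is subadditive in \<open>s\<close>.
\<close>

definition top_sum_bound :: "real \<Rightarrow> 'i set \<Rightarrow> ('i \<Rightarrow> real) \<Rightarrow> real \<Rightarrow> bool" where
  "top_sum_bound p I s B \<longleftrightarrow>
     (\<forall>F. F \<subseteq> I \<longrightarrow> finite F \<longrightarrow> (\<Sum>j\<in>F. \<bar>s j\<bar>) \<le> B * real (card F) powr (1 - 1 / p))"

text \<open>
  The discrete form of \<open>(d/dx) x powr a = a * x powr (a - 1)\<close>, which makes
  \<open>\<Sum>i\<le>n. i powr (a - 1)\<close> at most \<open>n powr a / a\<close>. It is the weighted inequality between the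
  arithmetic and the geometric mean of \<open>n\<close> and \<open>n + 1\<close>.
\<close>

lemma powr_minus_le_powr_increment:
  fixes a :: real
  assumes "0 < a" "a < 1"
  shows "a * real (Suc n) powr (a - 1) \<le> real (Suc n) powr a - real n powr a"
proof (cases "n = 0")
  case True
  then show ?thesis using assms by simp
next
  case False
  define m where "m = real (Suc n)"
  have m: "m > 0" "real n = m - 1" by (auto simp: m_def)
  have "real n powr a * m powr (1 - a) \<le> a * real n + (1 - a) * m"
    using Youngs_inequality_0[of a "1 - a" "real n" m] False assms m by auto
  also have "\<dots> = m - a" by (simp add: m algebra_simps)
  finally have "real n powr a * m powr (1 - a) * m powr (a - 1) \<le> (m - a) * m powr (a - 1)"
    by (intro mult_right_mono) auto
  moreover have "m powr (1 - a) * m powr (a - 1) = 1"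
    using m by (simp flip: powr_add)
  moreover have "m * m powr (a - 1) = m powr a"
    using m by (simp add: powr_mult_base)
  ultimately show ?thesis unfolding m_def[symmetric] by (simp add: algebra_simps)
qed

text \<open>
  Remove the smallest value from a set of \<open>n\<close> indices repeatedly. The smallest of \<open>n\<close> values is at
  most \<open>C * n powr (-1/p)\<close>, since \<open>n\<close> indices lie in every lower superlevel set.
\<close>

lemma weak_lp_imp_top_sum_bound:
  fixes p :: real
  assumes p: "p > 1" and s: "s \<in> weak_lp p I"
  shows "\<exists>B\<ge>0. top_sum_bound p I s B"
proof -
  obtain C where C: "C \<ge> 0" and fin: "\<And>t. t > 0 \<Longrightarrow> finite {i\<in>I. \<bar>s i\<bar> > t}"
    and card: "\<And>t. t > 0 \<Longrightarrow> real (card {i\<in>I. \<bar>s i\<bar> > t}) \<le> (C / t) powr p"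
    using s by (auto simp: weak_lp_def)
  define a where "a = 1 - 1 / p"
  have a: "0 < a" "a < 1" using p by (auto simp: a_def)
  \<comment> \<open>Superlevel sets are strict, hence the detour through some \<open>r\<close> below \<open>t\<close>.\<close>
  have small: "t \<le> C * real (card F) powr (a - 1)"
    if F: "F \<subseteq> I" "finite F" "F \<noteq> {}" and t: "\<And>i. i \<in> F \<Longrightarrow> t \<le> \<bar>s i\<bar>" for F t
  proof (rule ccontr)
    assume less: "\<not> ?thesis"
    have n: "real (card F) > 0" using F by (simp add: card_gt_0_iff)
    have "0 \<le> C * real (card F) powr (a - 1)" using C by simp
    then obtain r where r: "C * real (card F) powr (a - 1) < r" "r < t" "r > 0"
      using less dense[of "C * real (card F) powr (a - 1)" t] by (metis le_less_trans not_le)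
    have "F \<subseteq> {i\<in>I. \<bar>s i\<bar> > r}" using F t r by force
    then have "real (card F) \<le> (C / r) powr p"
      using card_mono[OF fin[OF r(3)], of F] card[OF r(3)] by linarith
    then have "real (card F) powr (1 / p) \<le> ((C / r) powr p) powr (1 / p)"
      using p by (intro powr_mono2) auto
    then have "real (card F) powr (1 / p) \<le> C / r"
      using p C r by (simp add: powr_powr)
    then have "r * real (card F) powr (1 / p) \<le> C"
      using r by (simp add: field_simps)
    then have "r * real (card F) powr (1 / p) * real (card F) powr (a - 1)
        \<le> C * real (card F) powr (a - 1)"
      by (intro mult_right_mono) auto
    then show False
      using r n by (simp add: a_def mult.assoc flip: powr_add)
  qed
  have "(\<Sum>j\<in>F. \<bar>s j\<bar>) \<le> C / a * real n powr a"
    if "F \<subseteq> I" "finite F" "card F = n" for F n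
    using that
  proof (induction n arbitrary: F)
    case 0
    then show ?case by simp
  next
    case (Suc n)
    then have ne: "F \<noteq> {}" by auto
    obtain i where i: "i \<in> F" "\<And>j. j \<in> F \<Longrightarrow> \<bar>s i\<bar> \<le> \<bar>s j\<bar>"
      using arg_min_if_finite[OF Suc.prems(2) ne, of "\<lambda>i. \<bar>s i\<bar>"] by (meson not_le)
    have "(\<Sum>j\<in>F. \<bar>s j\<bar>) = \<bar>s i\<bar> + (\<Sum>j\<in>F - {i}. \<bar>s j\<bar>)"
      using Suc.prems i by (simp add: sum.remove)
    also have "\<bar>s i\<bar> \<le> C * real (Suc n) powr (a - 1)"
      using small[of F "\<bar>s i\<bar>"] Suc.prems ne i by auto
    also have "\<dots> = C / a * (a * real (Suc n) powr (a - 1))" using a by simp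
    also have "\<dots> \<le> C / a * (real (Suc n) powr a - real n powr a)"
      using C a powr_minus_le_powr_increment[of a n] by (intro mult_left_mono) auto
    also have "(\<Sum>j\<in>F - {i}. \<bar>s j\<bar>) \<le> C / a * real n powr a"
      using Suc.prems i by (intro Suc.IH) auto
    finally show ?case by (simp add: algebra_simps)
  qed
  then show ?thesis
    using C a by (intro exI[of _ "C / a"]) (auto simp: top_sum_bound_def a_def)
qed

text \<open>
  A Chebyshev argument: \<open>n\<close> indices in the superlevel set of \<open>t\<close> have a sum of at least \<open>n * t\<close>,
  so that \<open>n powr (1/p) \<le> B / t\<close>.
\<close>

lemma top_sum_bound_imp_weak_lp:
  fixes p :: real
  assumes p: "p > 1" and B: "B \<ge> 0" "top_sum_bound p I s B"
  shows "s \<in> weak_lp p I"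
proof -
  have bd: "real (card F) \<le> (B / t) powr p"
    if t: "t > 0" and F: "finite F" "F \<subseteq> {i\<in>I. \<bar>s i\<bar> > t}" for t F
  proof (cases "F = {}")
    case False
    then have n: "real (card F) > 0" using F by (simp add: card_gt_0_iff)
    have "real (card F) * t \<le> (\<Sum>j\<in>F. \<bar>s j\<bar>)"
      using F by (intro sum_bounded_below) auto
    also have "\<dots> \<le> B * real (card F) powr (1 - 1 / p)"
      using B F by (auto simp: top_sum_bound_def)
    finally have "real (card F) * t * real (card F) powr (1 / p - 1)
        \<le> B * real (card F) powr (1 - 1 / p) * real (card F) powr (1 / p - 1)"
      by (intro mult_right_mono) auto
    then have "real (card F) powr (1 / p) * t \<le> B"
      using n by (simp add: mult.assoc flip: powr_add)
        (simp add: algebra_simps powr_mult_base flip: mult.assoc)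
    then have "real (card F) powr (1 / p) \<le> B / t" using t by (simp add: field_simps)
    then have "(real (card F) powr (1 / p)) powr p \<le> (B / t) powr p"
      using p by (intro powr_mono2) auto
    then show ?thesis using p n by (simp add: powr_powr)
  qed simp
  have "finite {i\<in>I. \<bar>s i\<bar> > t}" if t: "t > 0" for t
  proof (rule ccontr)
    assume inf: "infinite {i\<in>I. \<bar>s i\<bar> > t}"
    obtain n :: nat where n: "(B / t) powr p < real n" using reals_Archimedean2 by blast
    obtain F where "F \<subseteq> {i\<in>I. \<bar>s i\<bar> > t}" "finite F" "card F = n"
      using infinite_arbitrarily_large[OF inf] by blast
    then show False using bd[OF t] n by fastforce
  qed
  then show ?thesis
    using B bd by (auto simp: weak_lp_def)
qed

lemma weak_lp_norm_le:
  fixes p :: real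
  assumes p: "p > 1" and B: "B \<ge> 0" "top_sum_bound p I s B"
  shows "weak_lp_norm p I s \<le> ennreal B"
proof -
  have "real (card F) powr (- 1 + 1 / p) * (\<Sum>j\<in>F. \<bar>s j\<bar>) \<le> B"
    if F: "F \<subseteq> I" "finite F" "card F \<ge> 1" for F
  proof -
    have "real (card F) powr (- 1 + 1 / p) * (\<Sum>j\<in>F. \<bar>s j\<bar>)
      \<le> real (card F) powr (- 1 + 1 / p) * (B * real (card F) powr (1 - 1 / p))"
      using B F by (intro mult_left_mono) (auto simp: top_sum_bound_def)
    also have "\<dots> = B * (real (card F) powr (- 1 + 1 / p) * real (card F) powr (1 - 1 / p))"
      by simp
    also have "\<dots> = B" using F by (auto simp flip: powr_add)
    finally show ?thesis .
  qed
  then show ?thesis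
    using top_sum_bound_imp_weak_lp[OF assms] B
    by (auto simp: weak_lp_norm_def intro!: Sup_least ennreal_leI)
qed

lemma top_sum_bound_weak_lp_norm:
  fixes p :: real
  assumes p: "p > 1" and s: "s \<in> weak_lp p I"
  shows "\<exists>B\<ge>0. weak_lp_norm p I s = ennreal B \<and> top_sum_bound p I s B"
proof -
  obtain B0 where "B0 \<ge> 0" "top_sum_bound p I s B0"
    using weak_lp_imp_top_sum_bound[OF p s] by auto
  then have "weak_lp_norm p I s \<le> ennreal B0" by (intro weak_lp_norm_le p)
  then have "weak_lp_norm p I s < \<infinity>"
    by (auto simp: ennreal_less_top intro: le_less_trans)
  then obtain B where B: "B \<ge> 0" "weak_lp_norm p I s = ennreal B"
    by (cases "weak_lp_norm p I s") auto
  have "(\<Sum>j\<in>F. \<bar>s j\<bar>) \<le> B * real (card F) powr (1 - 1 / p)" if F: "F \<subseteq> I" "finite F" for F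
  proof (cases "F = {}")
    case False
    then have n: "card F \<ge> 1" using F by (simp add: Suc_leI card_gt_0_iff)
    have "ennreal (real (card F) powr (- 1 + 1 / p) * (\<Sum>j\<in>F. \<bar>s j\<bar>)) \<le> weak_lp_norm p I s"
      using s F n by (auto simp: weak_lp_norm_def intro!: Sup_upper)
    then have "real (card F) powr (- 1 + 1 / p) * (\<Sum>j\<in>F. \<bar>s j\<bar>) \<le> B"
      using B by (simp add: ennreal_le_iff)
    then have "real (card F) powr (1 - 1 / p) * (real (card F) powr (- 1 + 1 / p) * (\<Sum>j\<in>F. \<bar>s j\<bar>))
        \<le> real (card F) powr (1 - 1 / p) * B"
      by (intro mult_left_mono) auto
    moreover have one: "real (card F) powr (1 - 1 / p) * real (card F) powr (- 1 + 1 / p) = 1"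
      using F False by (simp flip: powr_add)
    then have "real (card F) powr (1 - 1 / p) * (real (card F) powr (- 1 + 1 / p) * S) = S" for S
      by (simp only: mult.assoc[symmetric] mult_1)
    ultimately show ?thesis by (metis mult.commute)
  qed simp
  then show ?thesis
    unfolding top_sum_bound_def by (intro exI[of _ B] conjI B) auto
qed

section \<open>Continuous functions are dense in the space of integrable functions\<close>

text \<open>
  The functions that can be approximated in the mean form a closed linear space. It contains the
  indicator of an open set, the increasing limit of the truncated multiples of the distance from
  the complement. Open sets are stable under intersection and generate the Borel sets, so it
  contains the indicators of all Borel sets (Dynkin's theorem) and then all integrable functions.
\<close>

lemma continuous_dense_in_L1:
  fixes f :: "'a::metric_space \<Rightarrow> real"
  assumes "finite_measure M" and sets: "sets M = sets (restrict_space borel Z)"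
    and f: "integrable M f" and "e > 0"
  shows "\<exists>g. continuous_on UNIV g \<and> integrable M g \<and> (\<integral>x. \<bar>f x - g x\<bar> \<partial>M) < e"
proof -
  interpret finite_measure M by fact
  define A where "A f \<longleftrightarrow>
    (\<forall>e>0. \<exists>g. continuous_on UNIV g \<and> integrable M g \<and> (\<integral>x. \<bar>f x - g x\<bar> \<partial>M) < e)"
    for f :: "'a \<Rightarrow> real"
  have meas: "g \<in> borel_measurable M" if "g \<in> borel_measurable borel" for g :: "'a \<Rightarrow> real"
  proof -
    have "g \<in> borel_measurable (restrict_space borel Z)"
      by (rule measurable_restrict_space1[OF that])
    then show ?thesis by (simp add: measurable_cong_sets[OF sets refl])
  qed
  have bounded: "integrable M g" if "g \<in> borel_measurable borel" "\<And>x. \<bar>g x\<bar> \<le> 1" for g :: "'a \<Rightarrow> real"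
    by (rule integrable_const_bound[where B = 1]) (simp_all add: meas that)
  have A_limit: "A f" if f: "integrable M f" and s: "\<And>i. integrable M (s i)" "\<And>i. A (s i)"
    and lim: "(\<lambda>i. \<integral>x. \<bar>f x - s i x\<bar> \<partial>M) \<longlonglongrightarrow> 0" for f and s :: "nat \<Rightarrow> 'a \<Rightarrow> real"
    unfolding A_def
  proof (intro allI impI)
    fix e :: real assume "e > 0"
    then obtain i where i: "(\<integral>x. \<bar>f x - s i x\<bar> \<partial>M) < e / 2"
      using order_tendstoD(2)[OF lim, of "e / 2"] by (auto dest: eventually_happens)
    obtain g where g: "continuous_on UNIV g" "integrable M g" "(\<integral>x. \<bar>s i x - g x\<bar> \<partial>M) < e / 2"
      using s(2)[of i] \<open>e > 0\<close> by (force simp: A_def dest: spec[of _ "e / 2"])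
    have "(\<integral>x. \<bar>f x - g x\<bar> \<partial>M) \<le> (\<integral>x. \<bar>f x - s i x\<bar> + \<bar>s i x - g x\<bar> \<partial>M)"
      using f s g by (intro integral_mono) auto
    also have "\<dots> = (\<integral>x. \<bar>f x - s i x\<bar> \<partial>M) + (\<integral>x. \<bar>s i x - g x\<bar> \<partial>M)"
      using f s g by (intro Bochner_Integration.integral_add) auto
    finally show "\<exists>g. continuous_on UNIV g \<and> integrable M g \<and> (\<integral>x. \<bar>f x - g x\<bar> \<partial>M) < e"
      using g i by (intro exI[of _ g]) auto
  qed
  have A_dominated: "A f" if "\<And>i. integrable M (s i)" "\<And>i. A (s i)"
    and "\<And>x. x \<in> space M \<Longrightarrow> (\<lambda>i. s i x) \<longlonglongrightarrow> f x" and w: "integrable M w" 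
    and bd: "\<And>i x. x \<in> space M \<Longrightarrow> \<bar>s i x\<bar> \<le> w x" and f: "integrable M f"
    for f w and s :: "nat \<Rightarrow> 'a \<Rightarrow> real"
  proof (rule A_limit[OF f that(1,2)])
    have "(\<lambda>i. \<integral>x. \<bar>f x - s i x\<bar> \<partial>M) \<longlonglongrightarrow> (\<integral>x. 0 \<partial>M)"
    proof (rule integral_dominated_convergence[where w = "\<lambda>x. \<bar>f x\<bar> + w x"])
      show "AE x in M. (\<lambda>i. \<bar>f x - s i x\<bar>) \<longlonglongrightarrow> 0"
      proof (rule AE_I2)
        fix x assume "x \<in> space M"
        then have "(\<lambda>i. \<bar>f x - s i x\<bar>) \<longlonglongrightarrow> \<bar>f x - f x\<bar>"
          by (intro tendsto_intros that)
        then show "(\<lambda>i. \<bar>f x - s i x\<bar>) \<longlonglongrightarrow> 0" by simp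
      qed
      show "AE x in M. norm \<bar>f x - s i x\<bar> \<le> \<bar>f x\<bar> + w x" for i
      proof (rule AE_I2)
        fix x assume "x \<in> space M"
        then show "norm \<bar>f x - s i x\<bar> \<le> \<bar>f x\<bar> + w x" using bd[of x i] by simp
      qed
    qed (simp_all add: borel_measurable_integrable f w that(1))
    then show "(\<lambda>i. \<integral>x. \<bar>f x - s i x\<bar> \<partial>M) \<longlonglongrightarrow> 0" by simp
  qed
  have A_add: "A (\<lambda>x. f x + g x)" if fg: "integrable M f" "integrable M g" "A f" "A g" for f g
    unfolding A_def
  proof (intro allI impI)
    fix e :: real assume "e > 0"
    then have "e / 2 > 0" by simp
    obtain u where u: "continuous_on UNIV u" "integrable M u" "(\<integral>x. \<bar>f x - u x\<bar> \<partial>M) < e / 2"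
      using fg(3) \<open>e / 2 > 0\<close> unfolding A_def by blast
    obtain v where v: "continuous_on UNIV v" "integrable M v" "(\<integral>x. \<bar>g x - v x\<bar> \<partial>M) < e / 2"
      using fg(4) \<open>e / 2 > 0\<close> unfolding A_def by blast
    have "(\<integral>x. \<bar>f x + g x - (u x + v x)\<bar> \<partial>M) \<le> (\<integral>x. \<bar>f x - u x\<bar> + \<bar>g x - v x\<bar> \<partial>M)"
      using fg u v by (intro integral_mono) auto
    also have "\<dots> = (\<integral>x. \<bar>f x - u x\<bar> \<partial>M) + (\<integral>x. \<bar>g x - v x\<bar> \<partial>M)"
      using fg u v by (intro Bochner_Integration.integral_add) auto
    finally show "\<exists>h. continuous_on UNIV h \<and> integrable M h \<and> (\<integral>x. \<bar>f x + g x - h x\<bar> \<partial>M) < e"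
      using u v by (intro exI[of _ "\<lambda>x. u x + v x"]) (auto intro!: continuous_intros)
  qed
  have A_continuous: "A g" if "continuous_on UNIV g" "integrable M g" for g
    unfolding A_def using that by (intro allI impI exI[of _ g]) auto
  have A_scale: "A (\<lambda>x. c * f x)" if f: "integrable M f" "A f" for f c
    unfolding A_def
  proof (intro allI impI)
    fix e :: real assume e: "e > 0"
    define d where "d = e / (\<bar>c\<bar> + 1)"
    have d: "d > 0" "\<bar>c\<bar> * d < e" using e by (auto simp: d_def field_simps)
    obtain g where g: "continuous_on UNIV g" "integrable M g" "(\<integral>x. \<bar>f x - g x\<bar> \<partial>M) < d"
      using f(2) d(1) unfolding A_def by blast
    have "(\<integral>x. \<bar>c * f x - c * g x\<bar> \<partial>M) = \<bar>c\<bar> * (\<integral>x. \<bar>f x - g x\<bar> \<partial>M)"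
      by (simp add: abs_mult flip: right_diff_distrib)
    also have "\<dots> \<le> \<bar>c\<bar> * d" using g by (intro mult_left_mono) auto
    finally show "\<exists>h. continuous_on UNIV h \<and> integrable M h \<and> (\<integral>x. \<bar>c * f x - h x\<bar> \<partial>M) < e"
      using g d by (intro exI[of _ "\<lambda>x. c * g x"]) (auto intro!: continuous_intros)
  qed
  have A_open: "A (indicator U)" if U: "open U" for U :: "'a set"
  proof (cases "U = UNIV")
    case True
    then show ?thesis using A_continuous[of "\<lambda>x. 1"] by (simp add: indicator_def)
  next
    case False
    \<comment> \<open>The case \<open>U = UNIV\<close> is separate because \<open>infdist x {} = 0\<close>.\<close>
    define s where "s n x = min 1 (real n * infdist x (- U))" for n x
    have c: "continuous_on UNIV (s n)" for n
      unfolding s_def by (intro continuous_intros)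
    have int: "integrable M (s n)" for n
      by (intro bounded borel_measurable_continuous_onI c) (auto simp: s_def infdist_nonneg)
    have lim: "(\<lambda>n. s n x) \<longlonglongrightarrow> indicator U x" for x
    proof (cases "x \<in> U")
      case True
      have pos: "infdist x (- U) > 0"
        using True U False in_closed_iff_infdist_zero[of "- U" x] infdist_nonneg[of x "- U"]
        by (force simp: closed_def)
      have "eventually (\<lambda>n. real n \<ge> 1 / infdist x (- U)) sequentially"
        using filterlim_real_sequentially by (auto simp: filterlim_at_top)
      then have "eventually (\<lambda>n. s n x = 1) sequentially"
        by eventually_elim (use pos in \<open>auto simp: s_def field_simps\<close>)
      then show ?thesis using True by (simp add: tendsto_eventually)
    next
      case False
      then show ?thesis by (simp add: s_def)
    qed
    have "integrable M (indicator U :: 'a \<Rightarrow> real)"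
      using U by (intro bounded) (auto simp: indicator_def)
    then show ?thesis
      using A_dominated[of s "indicator U" "\<lambda>x. 1"] int A_continuous[OF c int] lim
      by (auto simp: s_def infdist_nonneg)
  qed
  have A_borel: "A (indicator S)" if "S \<in> sets borel" for S :: "'a set"
  proof -
    have "Int_stable {S :: 'a set. open S}" by (auto simp: Int_stable_def)
    moreover have "{S :: 'a set. open S} \<subseteq> Pow UNIV" by auto
    moreover have "S \<in> sigma_sets UNIV {S. open S}" using that by (simp add: borel_def)
    ultimately show ?thesis
    proof (induction rule: sigma_sets_induct_disjoint)
      case (basic U)
      then show ?case using A_open by auto
    next
      case empty
      then show ?case using A_continuous[of "\<lambda>x. 0"] by (simp add: indicator_def)
    next
      case (compl T)
      then have T: "T \<in> sets borel" by (simp add: borel_def)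
      have T': "integrable M (indicator T :: 'a \<Rightarrow> real)"
        using T by (intro bounded) (auto simp: indicator_def)
      have "A (\<lambda>x. 1 + (-1) * indicator T x)"
        using T' compl by (intro A_add A_scale A_continuous[of "\<lambda>x. 1"]) auto
      moreover have "(\<lambda>x. 1 + (-1) * indicator T x) = (indicator (UNIV - T) :: 'a \<Rightarrow> real)"
        by (auto simp: indicator_def)
      ultimately show ?case by simp
    next
      case (union T)
      then have T: "T i \<in> sets borel" for i by (auto simp: borel_def)
      have T': "integrable M (indicator S :: 'a \<Rightarrow> real)" if "S \<in> sets borel" for S
        using that by (intro bounded) (auto simp: indicator_def)
      have part: "A (indicator (\<Union>i<n. T i))" for n
      proof (induction n)
        case 0
        then show ?case using A_continuous[of "\<lambda>x. 0"] by (simp add: indicator_def)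
      next
        case (Suc n)
        have "A (\<lambda>x. indicator (\<Union>i<n. T i) x + indicator (T n) x)"
          using Suc union.IH T by (intro A_add T') auto
        moreover have "(\<lambda>x. indicator (\<Union>i<n. T i) x + indicator (T n) x)
            = (indicator (\<Union>i<Suc n. T i) :: 'a \<Rightarrow> real)"
        proof (rule ext)
          have "T i \<inter> T n = {}" if "i < n" for i
            using union.hyps(1) that by (intro disjoint_family_onD[of T UNIV]) auto
          then have "(\<Union>i<n. T i) \<inter> T n = {}" by blast
          then show "indicator (\<Union>i<n. T i) x + indicator (T n) x
              = (indicator (\<Union>i<Suc n. T i) x :: real)" for x
            by (simp add: indicator_add lessThan_Suc Un_commute)
        qed
        ultimately show ?case by simp
      qed
      show ?case
      proof (rule A_dominated[where s = "\<lambda>n. indicator (\<Union>i<n. T i)" and w = "\<lambda>x. 1"])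
        show "(\<lambda>n. indicator (\<Union>i<n. T i) x) \<longlonglongrightarrow> (indicator (\<Union> (range T)) x :: real)" for x
          by (rule LIMSEQ_indicator_UN)
        show "\<bar>indicator (\<Union>i<n. T i) x\<bar> \<le> (1::real)" for n x
          by (simp add: indicator_def)
      qed (use T in \<open>auto intro!: part T'\<close>)
    qed
  qed
  have "A f" using f
  proof (induction rule: integrable_induct)
    case (base S c)
    then obtain T where T: "T \<in> sets borel" "S = Z \<inter> T"
      using sets by (auto simp: sets_restrict_space)
    have "integrable M (indicator T :: 'a \<Rightarrow> real)"
      using T by (intro bounded) (auto simp: indicator_def)
    then have *: "A (\<lambda>x. c * indicator T x)" by (intro A_scale A_borel T)
    have "space M = Z" using sets_eq_imp_space_eq[OF sets] by (simp add: space_restrict_space)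
    then have "(\<integral>x. \<bar>indicator S x *\<^sub>R c - g x\<bar> \<partial>M) = (\<integral>x. \<bar>c * indicator T x - g x\<bar> \<partial>M)" for g
      using T by (intro Bochner_Integration.integral_cong) (auto simp: indicator_def)
    then show ?case using * by (simp add: A_def)
  next
    case (add f g)
    then show ?case by (rule_tac A_add)
  next
    case (lim f s)
    then show ?case
      by (rule_tac A_dominated[where s = s and w = "\<lambda>x. 2 * \<bar>f x\<bar>"]) auto
  qed
  then show ?thesis using \<open>e > 0\<close> by (auto simp: A_def)
qed

section \<open>Packing estimates in a hyperbolic filling\<close>

lemma power_powr_swap: "(x ^ n) powr a = (x powr a) ^ n" if "x \<ge> 0" for x a :: real
  using that by (induction n) (auto simp: powr_mult)

text \<open>
  Edges between the levels \<open>k\<close> and \<open>Suc k\<close>. The set \<open>D\<close> has to meet the common part of the two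
  balls, not just one of them, as the chains of balls around the points of \<open>D\<close> use only such edges.
\<close>

definition cross_edges :: "'a::metric_space set \<Rightarrow> 'a filling \<Rightarrow> nat \<Rightarrow> 'a set \<Rightarrow> 'a edge set" where
  "cross_edges Z X k D = {{(k, B), (Suc k, B')} | B B'.
     B \<in> level_balls Z X k \<and> B' \<in> level_balls Z X (Suc k) \<and> B \<inter> B' \<inter> D \<noteq> {}}"

text \<open>
  Ahlfors regularity with one constant for both bounds, in real-valued form. As the space has
  finite measure, the upper bound extends to all radii, which spares a case distinction whenever a
  ball is enlarged.
\<close>

locale regular_space = finite_measure M
  for Z :: "'a::metric_space set" and M :: "'a measure" and Q c :: real +
  assumes Q_pos: "Q > 0" and compact_Z: "compact Z" and Z_nonempty: "Z \<noteq> {}"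
    and dist_le_1: "\<And>x y. x \<in> Z \<Longrightarrow> y \<in> Z \<Longrightarrow> dist x y \<le> 1"
    and sets_M: "sets M = sets (restrict_space borel Z)"
    and c_ge_1: "c \<ge> 1"
    and measure_zball_ge: "\<And>z r. z \<in> Z \<Longrightarrow> 0 < r \<Longrightarrow> r \<le> 1 \<Longrightarrow> r powr Q / c \<le> measure M (zball Z z r)"
    and measure_zball_le: "\<And>z r. z \<in> Z \<Longrightarrow> 0 < r \<Longrightarrow> measure M (zball Z z r) \<le> c * r powr Q"
begin

text \<open>
  The constant comes from a packing of balls of radius \<open>(1/2)^k / 2\<close> into a ball of radius
  \<open>10 * (1/2)^i + (1/2)^k / 2\<close>, at most \<open>21 * 2^(k-i)\<close> times larger.
\<close>

definition packing :: real where "packing = c\<^sup>2 * 21 powr Q"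

lemma packing_pos: "packing > 0" using c_ge_1 by (simp add: packing_def)

lemma space_M: "space M = Z"
  using sets_eq_imp_space_eq[OF sets_M] by (simp add: space_restrict_space)

lemma sets_zball: "zball Z z r \<in> sets M"
  by (auto simp: sets_M sets_restrict_space zball_def)

text \<open>
  The balls of radius \<open>h / 2\<close> around the points of \<open>A\<close> are disjoint and lie in the ball of radius
  \<open>R + h / 2\<close>; compare their measures.
\<close>

lemma card_separated_le:
  assumes A: "A \<subseteq> zball Z y R" "separated_set h A" and y: "y \<in> Z" and h: "0 < h" "h \<le> 1" and "R > 0"
  shows "finite A" "real (card A) \<le> c\<^sup>2 * ((R + h / 2) / (h / 2)) powr Q"
proof -
  have bd: "real (card F) \<le> c\<^sup>2 * ((R + h / 2) / (h / 2)) powr Q" if F: "F \<subseteq> A" "finite F" for F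
  proof -
    have FZ: "F \<subseteq> Z" using F A by (auto simp: zball_def)
    have "real (card F) * ((h / 2) powr Q / c) \<le> (\<Sum>z\<in>F. measure M (zball Z z (h / 2)))"
      using FZ h by (intro sum_bounded_below measure_zball_ge) auto
    also have "\<dots> = measure M (\<Union>z\<in>F. zball Z z (h / 2))"
    proof (rule finite_measure_finite_Union[symmetric])
      show "disjoint_family_on (\<lambda>z. zball Z z (h / 2)) F"
        unfolding disjoint_family_on_def
      proof (intro ballI impI)
        fix u v assume uv: "u \<in> F" "v \<in> F" "u \<noteq> v"
        then have "h \<le> dist u v" using A(2) F by (auto simp: separated_set_def)
        then show "zball Z u (h / 2) \<inter> zball Z v (h / 2) = {}"
          using dist_triangle_half_r[of _ u h v] by (fastforce simp: zball_def dist_commute)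
      qed
    qed (use F sets_zball in auto)
    also have "\<dots> \<le> measure M (zball Z y (R + h / 2))"
    proof (rule finite_measure_mono[OF _ sets_zball], rule subsetI)
      fix x assume "x \<in> (\<Union>z\<in>F. zball Z z (h / 2))"
      then obtain z where "z \<in> F" "dist z x < h / 2" "x \<in> Z" by (auto simp: zball_def)
      moreover have "dist y z < R" using \<open>z \<in> F\<close> F A by (auto simp: zball_def)
      ultimately show "x \<in> zball Z y (R + h / 2)"
        using dist_triangle[of y x z] by (auto simp: zball_def)
    qed
    also have "\<dots> \<le> c * (R + h / 2) powr Q"
      using y h \<open>R > 0\<close> by (intro measure_zball_le) auto
    finally have "real (card F) * ((h / 2) powr Q / c) \<le> c * (R + h / 2) powr Q" .
    then have "real (card F) * (h / 2) powr Q \<le> c\<^sup>2 * (R + h / 2) powr Q"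
      using c_ge_1 by (simp add: pos_divide_le_eq power2_eq_square mult_ac)
    moreover have "(h / 2) powr Q > 0" using h by simp
    ultimately have "real (card F) \<le> c\<^sup>2 * (R + h / 2) powr Q / (h / 2) powr Q"
      by (simp only: pos_le_divide_eq)
    moreover have "((R + h / 2) / (h / 2)) powr Q = (R + h / 2) powr Q / (h / 2) powr Q"
      by (rule powr_divide)
    ultimately show ?thesis by (simp only: times_divide_eq_right)
  qed
  show fin: "finite A"
  proof (rule ccontr)
    assume inf: "infinite A"
    obtain n :: nat where n: "c\<^sup>2 * ((R + h / 2) / (h / 2)) powr Q < real n"
      using reals_Archimedean2 by blast
    obtain F where "F \<subseteq> A" "finite F" "card F = n"
      using infinite_arbitrarily_large[OF inf] by blast
    then show False using bd[of F] n by simp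
  qed
  show "real (card A) \<le> c\<^sup>2 * ((R + h / 2) / (h / 2)) powr Q" by (rule bd[OF order_refl fin])
qed

end

locale filled_space = regular_space Z M Q c
  for Z :: "'a::metric_space set" and M Q c +
  fixes X :: "'a filling"
  assumes filling: "hyperbolic_filling Z X"
begin

lemma centers_separated: "separated_set ((1 / 2) ^ n) (centers X n)" "centers X n \<subseteq> Z" if "n \<ge> 1"
  using filling that
  by (auto simp: hyperbolic_filling_def maximal_separated_def powr_minus powr_realpow power_one_over
      inverse_eq_divide)

lemma level_balls_pos:
  "level_balls Z X n = (\<lambda>z. zball Z z (2 * (1 / 2) ^ n)) ` centers X n" if "n \<ge> 1"
  using that by (simp add: level_balls_def powr_diff powr_realpow power_one_over)

text \<open>By maximality: a point far from all centers could be added to them.\<close>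

lemma centers_dense:
  assumes n: "n \<ge> 1" and x: "x \<in> Z"
  shows "\<exists>z\<in>centers X n. dist z x < (1 / 2) ^ n"
proof (rule ccontr)
  assume "\<not> ?thesis"
  then have far: "\<And>z. z \<in> centers X n \<Longrightarrow> (1 / 2) ^ n \<le> dist z x" by force
  have "maximal_separated ((1 / 2) ^ n) Z (centers X n)"
    using filling n
    by (simp add: hyperbolic_filling_def powr_minus powr_realpow power_one_over inverse_eq_divide)
  moreover have "separated_set ((1 / 2) ^ n) (insert x (centers X n))"
    using far centers_separated[OF n] by (auto simp: separated_set_def dist_commute)
  ultimately have "insert x (centers X n) = centers X n"
    using x unfolding maximal_separated_def by blast
  then have "x \<in> centers X n" by blast
  then have "(1 / 2 :: real) ^ n \<le> 0" using far[of x] by simp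
  moreover have "(1 / 2 :: real) ^ n > 0" by simp
  ultimately show False by linarith
qed

text \<open>
  Level \<open>0\<close> fits the pattern of the other levels with any point as center, because the diameter
  is \<open>1\<close>. After this lemma it needs no separate treatment in the estimates of size.
\<close>

lemma level_ball_centers:
  obtains z where "\<And>B. B \<in> level_balls Z X k \<Longrightarrow> z B \<in> Z"
    "\<And>B. B \<in> level_balls Z X k \<Longrightarrow> zball Z (z B) ((1 / 2) ^ k) \<subseteq> B"
    "\<And>B. B \<in> level_balls Z X k \<Longrightarrow> B \<subseteq> zball Z (z B) (2 * (1 / 2) ^ k)"
    "\<And>B B'. B \<in> level_balls Z X k \<Longrightarrow> B' \<in> level_balls Z X k \<Longrightarrow> B \<noteq> B' \<Longrightarrow>
       (1 / 2) ^ k \<le> dist (z B) (z B')"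
proof (cases "k = 0")
  case True
  obtain z where "z \<in> Z" using Z_nonempty by auto
  then show ?thesis
    using True dist_le_1[OF \<open>z \<in> Z\<close>]
    by (intro that[of "\<lambda>_. z"]) (force simp: level_balls_def zball_def)+
next
  case False
  then have k: "k \<ge> 1" by simp
  have "\<forall>B\<in>level_balls Z X k. \<exists>z\<in>centers X k. B = zball Z z (2 * (1 / 2) ^ k)"
    using level_balls_pos[OF k] by auto
  then obtain z where z: "\<And>B. B \<in> level_balls Z X k \<Longrightarrow> z B \<in> centers X k"
    "\<And>B. B \<in> level_balls Z X k \<Longrightarrow> B = zball Z (z B) (2 * (1 / 2) ^ k)"
    by metis
  have sub: "zball Z (z B) ((1 / 2) ^ k) \<subseteq> B" "B \<subseteq> zball Z (z B) (2 * (1 / 2) ^ k)"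
    if "B \<in> level_balls Z X k" for B
  proof -
    have "zball Z (z B) ((1 / 2) ^ k) \<subseteq> zball Z (z B) (2 * (1 / 2) ^ k)"
      unfolding zball_def by (intro Int_mono subset_ball order_refl) simp
    then show "zball Z (z B) ((1 / 2) ^ k) \<subseteq> B" "B \<subseteq> zball Z (z B) (2 * (1 / 2) ^ k)"
      using z(2)[OF that] by blast+
  qed
  show ?thesis
  proof (rule that[of z])
    fix B B' assume B: "B \<in> level_balls Z X k" "B' \<in> level_balls Z X k" "B \<noteq> B'"
    then have "z B \<noteq> z B'" using z(2) by metis
    then show "(1 / 2) ^ k \<le> dist (z B) (z B')"
      using B z(1) centers_separated(1)[OF k] by (auto simp: separated_set_def)
  qed (use z(1) sub centers_separated(2)[OF k] in blast)+
qed

lemma level_ball_subset_Z: "B \<in> level_balls Z X k \<Longrightarrow> B \<subseteq> Z"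
  by (cases "k = 0") (auto simp: level_balls_def zball_def)

lemma level_ball_nonempty:
  assumes "B \<in> level_balls Z X k"
  shows "B \<noteq> {}"
proof -
  obtain z where "z \<in> Z" "zball Z z ((1 / 2) ^ k) \<subseteq> B"
    using assms by (metis level_ball_centers[of k])
  moreover from this(1) have "z \<in> zball Z z ((1 / 2) ^ k)" by (simp add: zball_def)
  ultimately show ?thesis by blast
qed

lemma sets_level_ball: "B \<in> level_balls Z X k \<Longrightarrow> B \<in> sets M"
proof -
  have "Z \<in> sets M" using sets.top[of M] by (simp add: space_M)
  then show "B \<in> level_balls Z X k \<Longrightarrow> B \<in> sets M"
    by (cases "k = 0") (auto simp: level_balls_def sets_zball)
qed

lemma level_ball_subset_zball:
  assumes "B \<in> level_balls Z X k" "x \<in> B"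
  shows "B \<subseteq> zball Z x (4 * (1 / 2) ^ k)"
proof -
  obtain z where z: "B \<subseteq> zball Z z (2 * (1 / 2) ^ k)"
    using assms(1) by (metis level_ball_centers[of k])
  show ?thesis
  proof
    fix y assume "y \<in> B"
    then have "y \<in> Z" "dist z y < 2 * (1 / 2) ^ k" "dist z x < 2 * (1 / 2) ^ k"
      using assms z by (auto simp: zball_def)
    then show "y \<in> zball Z x (4 * (1 / 2) ^ k)"
      using dist_triangle3[of x y z] by (auto simp: zball_def)
  qed
qed

lemma zball_subset_level_ball:
  assumes "x \<in> Z"
  shows "\<exists>B\<in>level_balls Z X k. zball Z x ((1 / 2) ^ k) \<subseteq> B"
proof (cases "k = 0")
  case True
  then show ?thesis by (auto simp: level_balls_def zball_def)
next
  case False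
  then have k: "k \<ge> 1" by simp
  obtain z where z: "z \<in> centers X k" "dist z x < (1 / 2) ^ k" using centers_dense[OF k assms] by auto
  have "zball Z x ((1 / 2) ^ k) \<subseteq> zball Z z (2 * (1 / 2) ^ k)"
  proof
    fix y assume "y \<in> zball Z x ((1 / 2) ^ k)"
    then show "y \<in> zball Z z (2 * (1 / 2) ^ k)"
      using z(2) dist_triangle[of z y x] by (auto simp: zball_def)
  qed
  then show ?thesis using z(1) by (auto simp: level_balls_pos[OF k])
qed

lemma level_balls_cover: "x \<in> Z \<Longrightarrow> \<exists>B\<in>level_balls Z X k. x \<in> B"
proof -
  assume "x \<in> Z"
  moreover from this have "x \<in> zball Z x ((1 / 2) ^ k)" by (simp add: zball_def)
  ultimately show ?thesis using zball_subset_level_ball by blast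
qed

lemma measure_level_ball:
  assumes "B \<in> level_balls Z X k"
  shows "((1 / 2) powr Q) ^ k / c \<le> measure M B" "measure M B \<le> c * 2 powr Q * ((1 / 2) powr Q) ^ k"
proof -
  obtain z where z: "z \<in> Z" "zball Z z ((1 / 2) ^ k) \<subseteq> B" "B \<subseteq> zball Z z (2 * (1 / 2) ^ k)"
    using assms by (metis level_ball_centers[of k])
  have "((1 / 2) ^ k) powr Q / c \<le> measure M (zball Z z ((1 / 2) ^ k))"
    using z by (intro measure_zball_ge) (auto simp: power_le_one)
  also have "\<dots> \<le> measure M B" by (intro finite_measure_mono z sets_level_ball[OF assms])
  finally show "((1 / 2) powr Q) ^ k / c \<le> measure M B" by (simp add: power_powr_swap)
  have "measure M B \<le> measure M (zball Z z (2 * (1 / 2) ^ k))"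
    by (intro finite_measure_mono z sets_zball)
  also have "\<dots> \<le> c * (2 * (1 / 2) ^ k) powr Q" using z by (intro measure_zball_le) auto
  also have "\<dots> = c * 2 powr Q * ((1 / 2) powr Q) ^ k" by (subst powr_mult) (auto simp: power_powr_swap)
  finally show "measure M B \<le> c * 2 powr Q * ((1 / 2) powr Q) ^ k" .
qed

lemma measure_level_ball_pos: "B \<in> level_balls Z X k \<Longrightarrow> measure M B > 0"
proof -
  have "0 < ((1 / 2) powr Q) ^ k / c" using c_ge_1 by simp
  then show "B \<in> level_balls Z X k \<Longrightarrow> measure M B > 0"
    using measure_level_ball(1) by (rule less_le_trans)
qed

text \<open>
  A ball of level \<open>k\<close> that meets the given ball has its center within \<open>10 * (1/2)^i\<close> of \<open>y\<close>, and
  distinct balls have separated centers. The factor \<open>8\<close> leaves room for a ball of level \<open>i\<close> (within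
  \<open>4 * (1/2)^i\<close> of each of its points) that meets another ball of level at least \<open>i\<close> containing \<open>y\<close>.
\<close>

lemma card_level_balls_meeting:
  assumes y: "y \<in> Z" and ik: "i \<le> k"
  defines "A \<equiv> {B \<in> level_balls Z X k. B \<inter> zball Z y (8 * (1 / 2) ^ i) \<noteq> {}}"
  shows "finite A" "real (card A) \<le> packing * (2 powr Q) ^ (k - i)"
proof -
  define h :: real where "h = (1 / 2) ^ k"
  define H :: real where "H = (1 / 2) ^ i"
  have h: "0 < h" "h \<le> 1" "h \<le> H"
    unfolding h_def H_def using ik by (auto intro: power_le_one power_decreasing)
  have H: "H = 2 ^ (k - i) * h"
    using ik by (simp add: h_def H_def power_diff power_one_over)
  obtain z where z: "\<And>B. B \<in> level_balls Z X k \<Longrightarrow> z B \<in> Z"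
    "\<And>B. B \<in> level_balls Z X k \<Longrightarrow> B \<subseteq> zball Z (z B) (2 * h)"
    "\<And>B B'. B \<in> level_balls Z X k \<Longrightarrow> B' \<in> level_balls Z X k \<Longrightarrow> B \<noteq> B' \<Longrightarrow> h \<le> dist (z B) (z B')"
    unfolding h_def by (rule level_ball_centers[of k]) blast
  have inj: "inj_on z A"
    using z(3) h(1) unfolding A_def inj_on_def by (metis (no_types, lifting) CollectD dist_self not_le)
  have "z ` A \<subseteq> zball Z y (10 * H)"
  proof
    fix u assume "u \<in> z ` A"
    then obtain B where "B \<in> A" "u = z B" by blast
    then obtain x where B: "B \<in> level_balls Z X k" "u = z B" "x \<in> B" "dist y x < 8 * H"
      unfolding A_def zball_def H_def by (auto simp: set_eq_iff)
    then have "x \<in> zball Z u (2 * h)" "u \<in> Z" using z(1,2) by auto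
    then have "dist u x < 2 * h" "u \<in> Z" by (auto simp: zball_def)
    then show "u \<in> zball Z y (10 * H)"
      using B h dist_triangle2[of y u x] by (auto simp: zball_def)
  qed
  moreover have "separated_set h (z ` A)"
    using z(3) by (auto simp: separated_set_def A_def)
  ultimately have fin: "finite (z ` A)"
    and "real (card (z ` A)) \<le> c\<^sup>2 * ((10 * H + h / 2) / (h / 2)) powr Q"
    using card_separated_le[of "z ` A" y "10 * H" h] y h by auto
  moreover have "(10 * H + h / 2) / (h / 2) \<le> 21 * 2 ^ (k - i)"
    using h by (simp add: H field_simps)
  then have "c\<^sup>2 * ((10 * H + h / 2) / (h / 2)) powr Q \<le> c\<^sup>2 * (21 * 2 ^ (k - i)) powr Q"
    using h Q_pos by (intro mult_left_mono powr_mono2) auto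
  moreover have "(21 * 2 ^ (k - i)) powr Q = 21 powr Q * (2 powr Q) ^ (k - i)"
    by (subst powr_mult) (auto simp: power_powr_swap)
  ultimately show "real (card A) \<le> packing * (2 powr Q) ^ (k - i)"
    by (simp add: card_image[OF inj] packing_def)
  show "finite A" using fin inj by (simp add: finite_image_iff)
qed

lemma finite_level_balls: "finite (level_balls Z X k)"
proof -
  obtain y where y: "y \<in> Z" using Z_nonempty by auto
  have "zball Z y 8 = Z" using dist_le_1[OF y] by (force simp: zball_def)
  then have "{B \<in> level_balls Z X k. B \<inter> zball Z y (8 * (1 / 2) ^ 0) \<noteq> {}} = level_balls Z X k"
    using level_ball_nonempty level_ball_subset_Z by fastforce
  then show ?thesis using card_level_balls_meeting(1)[OF y, of 0 k] by simp
qed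

lemma card_level_balls_containing:
  assumes "x \<in> Z"
  shows "real (card {B \<in> level_balls Z X k. x \<in> B}) \<le> packing"
proof -
  have "card {B \<in> level_balls Z X k. x \<in> B}
      \<le> card {B \<in> level_balls Z X k. B \<inter> zball Z x (8 * (1 / 2) ^ k) \<noteq> {}}"
    using assms by (intro card_mono card_level_balls_meeting) (auto simp: zball_def)
  then show ?thesis using card_level_balls_meeting(2)[OF assms, of k k] by simp
qed

lemma cross_edges_subset: "cross_edges Z X k D \<subseteq> edges Z X"
proof
  fix e assume "e \<in> cross_edges Z X k D"
  then obtain B B' where e: "e = {(k, B), (Suc k, B')}" "B \<in> level_balls Z X k"
    "B' \<in> level_balls Z X (Suc k)" "B \<inter> B' \<noteq> {}"
    by (auto simp: cross_edges_def)
  then show "e \<in> edges Z X"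
    unfolding edges_def
    by (intro CollectI exI[of _ "(k, B)"] exI[of _ "(Suc k, B')"]) (simp add: vertices_def)
qed

text \<open>
  There are \<open>O((2 powr Q) ^ (k - i))\<close> balls of level \<open>k\<close> near \<open>D\<close>, and each meets boundedly
  many balls of the next level.
\<close>

lemma card_cross_edges:
  assumes y: "y \<in> Z" and D: "D \<subseteq> zball Z y (8 * (1 / 2) ^ i)" and ik: "i \<le> k"
  shows "finite (cross_edges Z X k D)"
    "real (card (cross_edges Z X k D)) \<le> packing\<^sup>2 * 2 powr Q * (2 powr Q) ^ (k - i)"
proof -
  define A where "A = {B \<in> level_balls Z X k. B \<inter> zball Z y (8 * (1 / 2) ^ i) \<noteq> {}}"
  define N where "N B = {B' \<in> level_balls Z X (Suc k). B' \<inter> B \<noteq> {}}" for B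
  have A: "finite A" "real (card A) \<le> packing * (2 powr Q) ^ (k - i)"
    using card_level_balls_meeting[OF y ik] by (auto simp: A_def)
  have N: "finite (N B)" "real (card (N B)) \<le> packing * 2 powr Q" if BA: "B \<in> A" for B
  proof -
    obtain x where x: "x \<in> B" "B \<in> level_balls Z X k"
      using BA level_ball_nonempty[of B k] unfolding A_def by blast
    then have xZ: "x \<in> Z" using level_ball_subset_Z by auto
    have "zball Z x (4 * (1 / 2) ^ k) \<subseteq> zball Z x (8 * (1 / 2) ^ k)"
      unfolding zball_def by (intro Int_mono subset_ball order_refl) simp
    then have "N B \<subseteq> {B' \<in> level_balls Z X (Suc k). B' \<inter> zball Z x (8 * (1 / 2) ^ k) \<noteq> {}}"
      using level_ball_subset_zball[OF x(2,1)] by (auto simp: N_def)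
    note sub = card_mono[OF card_level_balls_meeting(1)[OF xZ, of k "Suc k"] this]
    show "finite (N B)" using finite_level_balls by (simp add: N_def)
    show "real (card (N B)) \<le> packing * 2 powr Q"
      using sub card_level_balls_meeting(2)[OF xZ, of k "Suc k"] by (simp add: Suc_diff_le)
  qed
  have sub: "cross_edges Z X k D \<subseteq> (\<lambda>(B, B'). {(k, B), (Suc k, B')}) ` (SIGMA B:A. N B)"
  proof
    fix e assume "e \<in> cross_edges Z X k D"
    then obtain B B' where "e = {(k, B), (Suc k, B')}" "B \<in> level_balls Z X k"
      "B' \<in> level_balls Z X (Suc k)" "B \<inter> B' \<inter> D \<noteq> {}"
      by (auto simp: cross_edges_def)
    then show "e \<in> (\<lambda>(B, B'). {(k, B), (Suc k, B')}) ` (SIGMA B:A. N B)"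
      using D by (intro image_eqI[of _ _ "(B, B')"]) (auto simp: A_def N_def)
  qed
  have fin: "finite (SIGMA B:A. N B)" using A N by blast
  show "finite (cross_edges Z X k D)" by (rule finite_subset[OF sub]) (use fin in simp)
  have "card (cross_edges Z X k D) \<le> card (SIGMA B:A. N B)"
    by (rule order_trans[OF card_mono[OF _ sub] card_image_le]) (use fin in auto)
  also have "\<dots> = (\<Sum>B\<in>A. card (N B))" using A N by (intro card_SigmaI) auto
  finally have "real (card (cross_edges Z X k D)) \<le> (\<Sum>B\<in>A. real (card (N B)))"
    by (simp flip: of_nat_sum)
  also have "\<dots> \<le> real (card A) * (packing * 2 powr Q)"
    by (intro sum_bounded_above N)
  also have "\<dots> \<le> packing * (2 powr Q) ^ (k - i) * (packing * 2 powr Q)"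
    using packing_pos A by (intro mult_right_mono) auto
  finally show "real (card (cross_edges Z X k D)) \<le> packing\<^sup>2 * 2 powr Q * (2 powr Q) ^ (k - i)"
    by (simp add: power2_eq_square mult_ac)
qed

text \<open>The orientation of an edge affects only the sign of the gradient.\<close>

lemma abs_gradient:
  assumes "e \<in> edges Z X" "e = {v, w}"
  shows "\<bar>gradient X u e\<bar> = \<bar>u v - u w\<bar>"
proof -
  have "{v, w} = {initial X e, terminal X e}"
    using filling assms by (auto simp: hyperbolic_filling_def)
  then have "v = initial X e \<and> w = terminal X e \<or> v = terminal X e \<and> w = initial X e"
    by (auto simp: doubleton_eq_iff)
  then show ?thesis by (auto simp: gradient_def)
qed

section \<open>Vanishing of the mean oscillation\<close>

text \<open>
  How far \<open>f\<close> is, in the mean, from being constant on the balls of level \<open>k\<close>. It controls the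
  error of stopping a chain of balls at level \<open>k\<close>.
\<close>

definition mean_oscillation :: "('a \<Rightarrow> real) \<Rightarrow> nat \<Rightarrow> real" where
  "mean_oscillation f k =
     (\<Sum>B\<in>level_balls Z X k. LINT x:B|M. \<bar>f x - poisson_ext M f (k, B)\<bar>)"

lemma set_integrable_level_ball:
  fixes f :: "'a \<Rightarrow> real"
  shows "integrable M f \<Longrightarrow> B \<in> level_balls Z X k \<Longrightarrow> set_integrable M B f"
  unfolding set_integrable_def
  by (intro integrable_mult_indicator sets_level_ball)

text \<open>
  Passing to the average is a contraction in the mean, so replacing \<open>f\<close> by \<open>g\<close> costs the mean
  distance twice, once for the functions and once for their averages.
\<close>

lemma oscillation_on_ball_le:
  assumes B: "B \<in> level_balls Z X k" and f: "integrable M f" and g: "integrable M g"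
    and osc: "\<And>x y. x \<in> B \<Longrightarrow> y \<in> B \<Longrightarrow> \<bar>g x - g y\<bar> \<le> e"
  shows "(LINT x:B|M. \<bar>f x - poisson_ext M f (k, B)\<bar>) \<le>
    2 * (LINT x:B|M. \<bar>f x - g x\<bar>) + e * measure M B"
proof -
  define m where "m = measure M B"
  have m: "m > 0" using measure_level_ball_pos[OF B] by (simp add: m_def)
  define d where "d = (LINT x:B|M. \<bar>f x - g x\<bar>)"
  note int = set_integrable_level_ball[OF _ B]
  have const: "(LINT x:B|M. a) = a * m" for a :: real
    using sets_level_ball[OF B] by (simp add: m_def set_lebesgue_integral_def)
  have pw: "\<bar>f x - poisson_ext M f (k, B)\<bar> \<le> \<bar>f x - g x\<bar> + (e + d / m)" if x: "x \<in> B" for x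
  proof -
    have "\<bar>LINT y:B|M. g x - g y\<bar> \<le> (LINT y:B|M. \<bar>g x - g y\<bar>)"
      using set_integral_norm_bound[OF int[of "\<lambda>y. g x - g y"]] g by simp
    also have "\<dots> \<le> (LINT y:B|M. e)"
      using g osc x by (intro set_integral_mono int) auto
    finally have "\<bar>g x * m - (LINT y:B|M. g y)\<bar> \<le> e * m"
      using g by (simp add: const set_integral_diff int)
    then have "\<bar>g x * m - (LINT y:B|M. g y)\<bar> / m \<le> e" using m by (simp add: field_simps)
    moreover have "\<bar>g x * m - (LINT y:B|M. g y)\<bar> / m = \<bar>g x - poisson_ext M g (k, B)\<bar>"
      using m by (simp add: poisson_ext_def m_def[symmetric] abs_div_pos diff_divide_distrib)
    moreover have "\<bar>LINT y:B|M. f y - g y\<bar> \<le> d"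
      unfolding d_def using set_integral_norm_bound[OF int[of "\<lambda>y. f y - g y"]] f g by simp
    then have "\<bar>(LINT y:B|M. f y) - (LINT y:B|M. g y)\<bar> / m \<le> d / m"
      using m f g by (simp add: set_integral_diff int divide_right_mono)
    moreover have "\<bar>(LINT y:B|M. f y) - (LINT y:B|M. g y)\<bar> / m
        = \<bar>poisson_ext M f (k, B) - poisson_ext M g (k, B)\<bar>"
      using m by (simp add: poisson_ext_def m_def[symmetric] abs_div_pos diff_divide_distrib)
    ultimately show ?thesis by linarith
  qed
  have "(LINT x:B|M. \<bar>f x - poisson_ext M f (k, B)\<bar>) \<le> (LINT x:B|M. \<bar>f x - g x\<bar> + (e + d / m))"
    using f g pw by (intro set_integral_mono int) auto
  also have "\<dots> = d + (e + d / m) * m"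
    using f g by (subst set_integral_add) (auto intro!: int simp: const d_def)
  also have "\<dots> = 2 * d + e * m" using m by (simp add: field_simps)
  finally show ?thesis by (simp add: d_def m_def)
qed

text \<open>The overlap of the balls of one level is bounded.\<close>

lemma sum_level_ball_integrals_le:
  fixes h :: "'a \<Rightarrow> real"
  assumes h: "integrable M h" "\<And>x. h x \<ge> 0"
  shows "(\<Sum>B\<in>level_balls Z X k. LINT x:B|M. h x) \<le> packing * (\<integral>x. h x \<partial>M)"
proof -
  have "(\<Sum>B\<in>level_balls Z X k. LINT x:B|M. h x)
      = (\<integral>x. (\<Sum>B\<in>level_balls Z X k. indicator B x * h x) \<partial>M)"
    using set_integrable_level_ball[OF h(1)]
    by (subst Bochner_Integration.integral_sum) (auto simp: set_lebesgue_integral_def set_integrable_def)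
  also have "\<dots> \<le> (\<integral>x. packing * h x \<partial>M)"
  proof (rule integral_mono)
    show "integrable M (\<lambda>x. \<Sum>B\<in>level_balls Z X k. indicator B x * h x)"
      using set_integrable_level_ball[OF h(1)]
      by (intro Bochner_Integration.integrable_sum) (auto simp: set_integrable_def)
    show "integrable M (\<lambda>x. packing * h x)" using h by simp
    fix x assume "x \<in> space M"
    then have x: "x \<in> Z" by (simp add: space_M)
    have "(\<Sum>B\<in>level_balls Z X k. indicator B x * h x)
        = (\<Sum>B\<in>level_balls Z X k. indicator B x) * h x"
      by (simp add: sum_distrib_right)
    also have "(\<Sum>B\<in>level_balls Z X k. indicator B x) = real (card {B \<in> level_balls Z X k. x \<in> B})"
      using finite_level_balls by (simp add: indicator_def sum.If_cases Int_def)
    also have "\<dots> * h x \<le> packing * h x"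
      using card_level_balls_containing[OF x] h(2) by (intro mult_right_mono) auto
    finally show "(\<Sum>B\<in>level_balls Z X k. indicator B x * h x) \<le> packing * h x" .
  qed
  finally show ?thesis by simp
qed

text \<open>
  A substitute for Lebesgue's differentiation theorem. A continuous function is uniformly continuous
  on the compact space, hence oscillates little on small balls; density does the rest.
\<close>

lemma mean_oscillation_tendsto_0:
  assumes f: "integrable M f"
  shows "mean_oscillation f \<longlonglongrightarrow> 0"
proof (rule LIMSEQ_I)
  fix r :: real assume r: "r > 0"
  define m where "m = measure M Z"
  have "m \<ge> 0" by (simp add: m_def)
  define N where "N = packing * (m + 2)"
  have "N > 0" using packing_pos \<open>m \<ge> 0\<close> by (simp add: N_def)
  \<comment> \<open>The final bound is \<open>N * e\<close>: density contributes \<open>2 * e\<close>, uniform continuity \<open>e * m\<close>.\<close>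
  define e where "e = r / (2 * N)"
  have "packing * (2 * e + e * m) = N * e" by (simp add: N_def algebra_simps)
  also have "\<dots> < r" using r \<open>N > 0\<close> by (simp add: e_def)
  finally have e: "e > 0" "packing * (2 * e + e * m) < r"
    using r \<open>N > 0\<close> by (simp_all add: e_def)
  obtain g where g: "continuous_on UNIV g" "integrable M g" "(\<integral>x. \<bar>f x - g x\<bar> \<partial>M) < e"
    using continuous_dense_in_L1[OF finite_measure_axioms sets_M f e(1)] by auto
  have "uniformly_continuous_on Z g"
    using g(1) compact_Z by (intro compact_uniformly_continuous) (auto intro: continuous_on_subset)
  then obtain d where d: "d > 0" "\<And>x y. x \<in> Z \<Longrightarrow> y \<in> Z \<Longrightarrow> dist y x < d \<Longrightarrow> dist (g y) (g x) < e"
    using e(1) unfolding uniformly_continuous_on_def by metis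
  have "(\<lambda>k. 4 * (1 / 2) ^ k :: real) \<longlonglongrightarrow> 4 * 0"
    by (intro tendsto_mult tendsto_const LIMSEQ_power_zero) auto
  then have "eventually (\<lambda>k. 4 * (1 / 2) ^ k < d) sequentially"
    by (rule order_tendstoD(2)) (use d(1) in simp)
  then obtain k0 where k0: "\<And>k. k \<ge> k0 \<Longrightarrow> 4 * (1 / 2) ^ k < d"
    by (auto simp: eventually_sequentially)
  have "norm (mean_oscillation f k - 0) < r" if k: "k \<ge> k0" for k
  proof -
    have g_osc: "\<bar>g x - g y\<bar> \<le> e" if "B \<in> level_balls Z X k" "x \<in> B" "y \<in> B" for B x y
    proof -
      have "y \<in> zball Z x (4 * (1 / 2) ^ k)" using level_ball_subset_zball that by blast
      then have "dist x y < d" "y \<in> Z" using k0[OF k] by (auto simp: zball_def)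
      moreover have "x \<in> Z" using level_ball_subset_Z that by blast
      ultimately show ?thesis using d(2)[of y x] by (auto simp: dist_real_def)
    qed
    have "mean_oscillation f k \<le>
        (\<Sum>B\<in>level_balls Z X k. 2 * (LINT x:B|M. \<bar>f x - g x\<bar>) + e * measure M B)"
      unfolding mean_oscillation_def
      by (intro sum_mono oscillation_on_ball_le f g g_osc)
    also have "\<dots> = 2 * (\<Sum>B\<in>level_balls Z X k. LINT x:B|M. \<bar>f x - g x\<bar>)
        + e * (\<Sum>B\<in>level_balls Z X k. LINT x:B|M. 1)"
      using sets_level_ball
      by (simp add: sum.distrib sum_distrib_left set_lebesgue_integral_def)
    also have "\<dots> \<le> 2 * (packing * (\<integral>x. \<bar>f x - g x\<bar> \<partial>M)) + e * (packing * (\<integral>x. 1 \<partial>M))"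
      using f g(2) e(1)
      by (intro add_mono mult_left_mono sum_level_ball_integrals_le) auto
    also have "\<dots> \<le> 2 * (packing * e) + e * (packing * m)"
      using g(3) packing_pos by (auto simp: m_def space_M)
    also have "\<dots> < r" using e(2) by (simp add: algebra_simps)
    finally have "mean_oscillation f k < r" .
    moreover have "mean_oscillation f k \<ge> 0"
      by (auto simp: mean_oscillation_def set_lebesgue_integral_def intro!: sum_nonneg integral_nonneg)
    ultimately show ?thesis by simp
  qed
  then show "\<exists>k0. \<forall>k\<ge>k0. norm (mean_oscillation f k - 0) < r" by blast
qed

section \<open>Telescoping down the filling\<close>

text \<open>
  The right-hand side sums over all edges around \<open>x\<close>, not only over those of the chosen chain. Thus
  the choice of the chain need not be measurable in \<open>x\<close>, while the bound is.
\<close>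

lemma descending_chain:
  fixes u :: "'a vertex \<Rightarrow> real"
  assumes D: "D \<in> level_balls Z X i" "x \<in> D"
  shows "\<exists>B\<in>level_balls Z X (i + J). x \<in> B \<and> \<bar>u (i + J, B) - u (i, D)\<bar> \<le>
    (\<Sum>j<J. \<Sum>e\<in>cross_edges Z X (i + j) {x}. \<bar>gradient X u e\<bar>)"
proof (induction J)
  case 0
  then show ?case using D by auto
next
  case (Suc J)
  then obtain B where B: "B \<in> level_balls Z X (i + J)" "x \<in> B" "\<bar>u (i + J, B) - u (i, D)\<bar> \<le>
    (\<Sum>j<J. \<Sum>e\<in>cross_edges Z X (i + j) {x}. \<bar>gradient X u e\<bar>)"
    by auto
  have x: "x \<in> Z" using level_ball_subset_Z D by auto
  obtain B' where B': "B' \<in> level_balls Z X (Suc (i + J))" "x \<in> B'"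
    using level_balls_cover[OF x] by blast
  let ?e = "{(i + J, B), (Suc (i + J), B')}"
  have e: "?e \<in> cross_edges Z X (i + J) {x}"
    using B B' by (auto simp: cross_edges_def)
  have "{x} \<subseteq> zball Z x (8 * (1 / 2) ^ (i + J))" using x by (simp add: zball_def)
  then have "finite (cross_edges Z X (i + J) {x})"
    by (intro card_cross_edges(1)[OF x, of _ "i + J"]) auto
  then have "\<bar>gradient X u ?e\<bar> \<le> (\<Sum>e\<in>cross_edges Z X (i + J) {x}. \<bar>gradient X u e\<bar>)"
    using e by (intro member_le_sum[where f = "\<lambda>e. \<bar>gradient X u e\<bar>"]) auto
  moreover have "\<bar>gradient X u ?e\<bar> = \<bar>u (i + J, B) - u (Suc (i + J), B')\<bar>"
    using e cross_edges_subset by (intro abs_gradient) auto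
  ultimately have "\<bar>u (i + Suc J, B') - u (i, D)\<bar> \<le>
    (\<Sum>j<Suc J. \<Sum>e\<in>cross_edges Z X (i + j) {x}. \<bar>gradient X u e\<bar>)"
    using B(3) by simp
  then show ?case using B' by auto
qed

text \<open>
  The set \<open>\<Inter> (snd ` e)\<close> is the common part of the two balls of \<open>e\<close>: the points whose chains may
  pass through \<open>e\<close>.
\<close>

lemma cross_edge_overlap:
  assumes "e \<in> cross_edges Z X k D"
  shows "\<Inter> (snd ` e) \<in> sets M" "measure M (\<Inter> (snd ` e)) \<le> c * 2 powr Q * ((1 / 2) powr Q) ^ k"
proof -
  obtain B B' where e: "e = {(k, B), (Suc k, B')}"
    and B: "B \<in> level_balls Z X k" "B' \<in> level_balls Z X (Suc k)"
    using assms by (auto simp: cross_edges_def)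
  have eq: "\<Inter> (snd ` e) = B \<inter> B'" by (simp add: e)
  show "\<Inter> (snd ` e) \<in> sets M" unfolding eq using B by (intro sets.Int sets_level_ball)
  have "measure M (\<Inter> (snd ` e)) \<le> measure M B"
    unfolding eq by (intro finite_measure_mono sets_level_ball[OF B(1)]) auto
  also have "\<dots> \<le> c * 2 powr Q * ((1 / 2) powr Q) ^ k" by (rule measure_level_ball[OF B(1)])
  finally show "measure M (\<Inter> (snd ` e)) \<le> c * 2 powr Q * ((1 / 2) powr Q) ^ k" .
qed

lemma cross_edges_singleton:
  assumes "x \<in> D"
  shows "cross_edges Z X k {x} = {e \<in> cross_edges Z X k D. x \<in> \<Inter> (snd ` e)}"
proof
  show "cross_edges Z X k {x} \<subseteq> {e \<in> cross_edges Z X k D. x \<in> \<Inter> (snd ` e)}"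
    using assms by (force simp: cross_edges_def)
  show "{e \<in> cross_edges Z X k D. x \<in> \<Inter> (snd ` e)} \<subseteq> cross_edges Z X k {x}"
  proof
    fix e assume "e \<in> {e \<in> cross_edges Z X k D. x \<in> \<Inter> (snd ` e)}"
    then obtain B B' where e: "e = {(k, B), (Suc k, B')}" "B \<in> level_balls Z X k"
      "B' \<in> level_balls Z X (Suc k)" "x \<in> \<Inter> (snd ` e)"
      unfolding cross_edges_def by blast
    then have "x \<in> B" "x \<in> B'" by auto
    then show "e \<in> cross_edges Z X k {x}" using e(1-3) unfolding cross_edges_def by blast
  qed
qed

lemma cross_edges_of_ball:
  assumes "D \<in> level_balls Z X i" "i \<le> k"
  shows "finite (cross_edges Z X k D)"
    "real (card (cross_edges Z X k D)) \<le> packing\<^sup>2 * 2 powr Q * (2 powr Q) ^ (k - i)"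
proof -
  obtain x where x: "x \<in> D" "x \<in> Z"
    using level_ball_nonempty[OF assms(1)] level_ball_subset_Z[OF assms(1)] by blast
  have "zball Z x (4 * (1 / 2) ^ i) \<subseteq> zball Z x (8 * (1 / 2) ^ i)"
    unfolding zball_def by (intro Int_mono subset_ball order_refl) simp
  then have "D \<subseteq> zball Z x (8 * (1 / 2) ^ i)" using level_ball_subset_zball[OF assms(1) x(1)] by blast
  then show "finite (cross_edges Z X k D)"
    "real (card (cross_edges Z X k D)) \<le> packing\<^sup>2 * 2 powr Q * (2 powr Q) ^ (k - i)"
    using card_cross_edges[OF x(2) _ assms(2)] by auto
qed

text \<open>
  The integral over \<open>S\<close> of the pointwise estimate along chains that start in \<open>D\<close> and have length
  \<open>J\<close>. The set \<open>S\<close> will be a ball of the other filling.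
\<close>

lemma mean_minus_poisson_le:
  fixes f :: "'a \<Rightarrow> real"
  defines "u \<equiv> poisson_ext M f"
  assumes f: "integrable M f" and D: "D \<in> level_balls Z X i" and S: "S \<in> sets M" "S \<subseteq> D"
    and pos: "measure M S > 0"
  shows "measure M S * \<bar>u (m, S) - u (i, D)\<bar> \<le> mean_oscillation f (i + J) +
    (\<Sum>j<J. \<Sum>e\<in>cross_edges Z X (i + j) D. \<bar>gradient X u e\<bar> * (c * 2 powr Q * ((1 / 2) powr Q) ^ (i + j)))"
proof -
  \<comment> \<open>\<open>R1\<close> bounds the error at the end of the chain through \<open>x\<close>, \<open>R2\<close> the increments along it.\<close>
  define R1 where "R1 x = (\<Sum>B\<in>level_balls Z X (i + J). indicator B x * \<bar>f x - u (i + J, B)\<bar>)" for x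
  define R2 where "R2 x = (\<Sum>j<J. \<Sum>e\<in>cross_edges Z X (i + j) D.
    \<bar>gradient X u e\<bar> * indicator (\<Inter> (snd ` e)) x)" for x
  have fin: "finite (cross_edges Z X (i + j) D)" for j
    using cross_edges_of_ball(1)[OF D] by simp
  have R1: "integrable M R1" "(\<integral>x. R1 x \<partial>M) = mean_oscillation f (i + J)"
  proof -
    have *: "integrable M (\<lambda>x. indicator B x * \<bar>f x - u (i + J, B)\<bar>)" if "B \<in> level_balls Z X (i + J)" for B
      using set_integrable_level_ball[OF _ that, of "\<lambda>x. \<bar>f x - u (i + J, B)\<bar>"] f
      by (simp add: set_integrable_def)
    show "integrable M R1" unfolding R1_def by (intro Bochner_Integration.integrable_sum *)
    show "(\<integral>x. R1 x \<partial>M) = mean_oscillation f (i + J)"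
      unfolding R1_def mean_oscillation_def using *
      by (subst Bochner_Integration.integral_sum) (auto simp: set_lebesgue_integral_def u_def)
  qed
  have ind: "integrable M (\<lambda>x. indicator (\<Inter> (snd ` e)) x :: real)"
    "(\<integral>x. indicator (\<Inter> (snd ` e)) x \<partial>M) = measure M (\<Inter> (snd ` e))"
    if "e \<in> cross_edges Z X (i + j) D" for e j
    using cross_edge_overlap(1)[OF that] by (auto simp: emeasure_eq_measure sets.Int_space_eq2)
  have R2_int: "integrable M R2"
    unfolding R2_def by (intro Bochner_Integration.integrable_sum integrable_mult_right ind)
  have "(\<integral>x. R2 x \<partial>M) = (\<Sum>j<J. \<Sum>e\<in>cross_edges Z X (i + j) D.
      \<bar>gradient X u e\<bar> * measure M (\<Inter> (snd ` e)))"
  proof -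
    have int: "integrable M (\<lambda>x. \<bar>gradient X u e\<bar> * indicator (\<Inter> (snd ` e)) x)"
      if "e \<in> cross_edges Z X (i + j) D" for e j
      by (intro integrable_mult_right ind(1)[OF that])
    have one: "(\<integral>x. \<bar>gradient X u e\<bar> * indicator (\<Inter> (snd ` e)) x \<partial>M)
        = \<bar>gradient X u e\<bar> * measure M (\<Inter> (snd ` e))" if "e \<in> cross_edges Z X (i + j) D" for e j
      by (subst integral_mult_right_zero) (simp only: ind(2)[OF that])
    have "(\<integral>x. R2 x \<partial>M) = (\<Sum>j<J. \<integral>x. (\<Sum>e\<in>cross_edges Z X (i + j) D.
        \<bar>gradient X u e\<bar> * indicator (\<Inter> (snd ` e)) x) \<partial>M)"
      unfolding R2_def
      by (intro Bochner_Integration.integral_sum Bochner_Integration.integrable_sum int)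
    also have "\<dots> = (\<Sum>j<J. \<Sum>e\<in>cross_edges Z X (i + j) D.
        \<integral>x. \<bar>gradient X u e\<bar> * indicator (\<Inter> (snd ` e)) x \<partial>M)"
      by (intro sum.cong refl Bochner_Integration.integral_sum int)
    also have "\<dots> = (\<Sum>j<J. \<Sum>e\<in>cross_edges Z X (i + j) D.
        \<bar>gradient X u e\<bar> * measure M (\<Inter> (snd ` e)))"
      by (intro sum.cong refl one)
    finally show ?thesis .
  qed
  also have "\<dots> \<le> (\<Sum>j<J. \<Sum>e\<in>cross_edges Z X (i + j) D.
      \<bar>gradient X u e\<bar> * (c * 2 powr Q * ((1 / 2) powr Q) ^ (i + j)))"
    by (intro sum_mono mult_left_mono cross_edge_overlap) auto
  finally have R2: "(\<integral>x. R2 x \<partial>M) \<le> \<dots>" .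
  have nonneg: "R1 x \<ge> 0" "R2 x \<ge> 0" for x
    by (auto simp: R1_def R2_def intro!: sum_nonneg)
  have pw: "\<bar>f x - u (i, D)\<bar> \<le> R1 x + R2 x" if x: "x \<in> D" for x
  proof -
    obtain B where B: "B \<in> level_balls Z X (i + J)" "x \<in> B" "\<bar>u (i + J, B) - u (i, D)\<bar> \<le>
        (\<Sum>j<J. \<Sum>e\<in>cross_edges Z X (i + j) {x}. \<bar>gradient X u e\<bar>)"
      using descending_chain[OF D x] by blast
    \<comment> \<open>Among the terms of \<open>R1\<close>, the one for the last ball of the chain matters.\<close>
    have "\<bar>f x - u (i + J, B)\<bar> = indicator B x * \<bar>f x - u (i + J, B)\<bar>" using B by simp
    also have "\<dots> \<le> R1 x"
      unfolding R1_def using B finite_level_balls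
      by (intro member_le_sum[where f = "\<lambda>B. indicator B x * \<bar>f x - u (i + J, B)\<bar>"]) auto
    finally have 1: "\<bar>f x - u (i + J, B)\<bar> \<le> R1 x" .
    have "(\<Sum>e\<in>cross_edges Z X (i + j) {x}. \<bar>gradient X u e\<bar>)
        = (\<Sum>e\<in>cross_edges Z X (i + j) D. \<bar>gradient X u e\<bar> * indicator (\<Inter> (snd ` e)) x)" for j
      unfolding cross_edges_singleton[OF x]
      by (rule sum.mono_neutral_cong_left) (use fin in \<open>auto simp: indicator_def\<close>)
    then have "\<bar>u (i + J, B) - u (i, D)\<bar> \<le> R2 x" using B(3) by (simp add: R2_def)
    then show ?thesis using 1 by linarith
  qed
  have int: "set_integrable M S h" if "integrable M h" for h :: "'a \<Rightarrow> real"
    unfolding set_integrable_def by (intro integrable_mult_indicator S that)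
  have "measure M S * \<bar>u (m, S) - u (i, D)\<bar> = \<bar>measure M S * u (m, S) - u (i, D) * measure M S\<bar>"
    using pos by (simp add: abs_mult mult.commute flip: right_diff_distrib)
  also have "measure M S * u (m, S) = (LINT x:S|M. f x)"
    using pos by (simp add: u_def poisson_ext_def)
  also have "u (i, D) * measure M S = (LINT x:S|M. u (i, D))"
    using S by (simp add: set_lebesgue_integral_def)
  also have "(LINT x:S|M. f x) - (LINT x:S|M. u (i, D)) = (LINT x:S|M. f x - u (i, D))"
    using f by (simp add: set_integral_diff int)
  also have "\<bar>\<dots>\<bar> \<le> (LINT x:S|M. \<bar>f x - u (i, D)\<bar>)"
    using set_integral_norm_bound[OF int[of "\<lambda>x. f x - u (i, D)"]] f by simp
  also have "\<dots> \<le> (\<integral>x. R1 x + R2 x \<partial>M)"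
    unfolding set_lebesgue_integral_def
  proof (rule integral_mono)
    show "integrable M (\<lambda>x. indicator S x *\<^sub>R \<bar>f x - u (i, D)\<bar>)"
      using int[of "\<lambda>x. \<bar>f x - u (i, D)\<bar>"] f by (simp add: set_integrable_def)
    show "integrable M (\<lambda>x. R1 x + R2 x)" using R1 R2_int by simp
    show "indicator S x *\<^sub>R \<bar>f x - u (i, D)\<bar> \<le> R1 x + R2 x" for x
      using pw[of x] S nonneg[of x] by (auto simp: indicator_def)
  qed
  also have "\<dots> = (\<integral>x. R1 x \<partial>M) + (\<integral>x. R2 x \<partial>M)"
    using R1 R2_int by (intro Bochner_Integration.integral_add)
  finally show ?thesis using R1 R2 by linarith
qed

section \<open>Comparison of two fillings\<close>

text \<open>
  The ball \<open>D\<close> of level \<open>i\<close> of this filling contains both balls of the edge \<open>e\<close> of \<open>X'\<close> and is of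
  comparable size.
\<close>

definition dominates :: "'a filling \<Rightarrow> 'a edge \<Rightarrow> nat \<Rightarrow> 'a set \<Rightarrow> bool" where
  "dominates X' e i D \<longleftrightarrow> D \<in> level_balls Z X i \<and>
     (\<forall>v\<in>e. i \<le> fst v \<and> fst v \<le> i + 5 \<and> snd v \<in> level_balls Z X' (fst v) \<and> snd v \<subseteq> D)"

text \<open>
  Let \<open>z\<close> lie in both balls of the edge and let \<open>n\<close> be the level of one of them. Both balls lie
  within \<open>8 * (1/2)^n\<close> of \<open>z\<close>, and four levels higher some ball of this filling contains all points
  within \<open>16 * (1/2)^n\<close> of \<open>z\<close>. For \<open>n < 4\<close> the truncated subtraction gives level \<open>0\<close>, the whole
  space.
\<close>

lemma exists_dominating_ball:
  assumes X': "filled_space Z M Q c X'" and e: "e \<in> edges Z X'"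
  shows "\<exists>i D. dominates X' e i D"
proof -
  interpret X': filled_space Z M Q c X' by (rule X')
  obtain v w where vw: "e = {v, w}" "v \<in> vertices Z X'" "w \<in> vertices Z X'"
    "\<bar>int (fst v) - int (fst w)\<bar> \<le> 1" "snd v \<inter> snd w \<noteq> {}"
    using e unfolding edges_def by blast
  then obtain z where z: "z \<in> snd v" "z \<in> snd w" by auto
  define i where "i = fst v - 4"
  have lev: "snd x \<in> level_balls Z X' (fst x)" if "x \<in> e" for x
    using that vw by (auto simp: vertices_def)
  have "z \<in> Z" using X'.level_ball_subset_Z[OF lev[of v]] z(1) vw(1) by auto
  then obtain D where D: "D \<in> level_balls Z X i" "zball Z z ((1 / 2) ^ i) \<subseteq> D"
    using zball_subset_level_ball by blast
  have "snd x \<subseteq> D \<and> i \<le> fst x \<and> fst x \<le> i + 5" if x: "x \<in> e" for x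
  proof -
    have near: "fst v \<le> fst x + 1" "fst x \<le> fst v + 1" and zx: "z \<in> snd x"
      using x vw z by auto
    have "snd x \<subseteq> D"
    proof (cases "i = 0")
      case True
      then have "D = Z" using D(1) by (simp add: level_balls_def)
      then show ?thesis using X'.level_ball_subset_Z lev[OF x] by auto
    next
      case False
      then have "i + 3 \<le> fst x" using near by (simp add: i_def)
      then have "(1 / 2 :: real) ^ fst x \<le> (1 / 2) ^ (i + 3)" by (intro power_decreasing) auto
      moreover have "(1 / 2 :: real) ^ (i + 3) = (1 / 2) ^ i / 8"
        by (simp add: power_add power3_eq_cube)
      ultimately have "4 * (1 / 2) ^ fst x \<le> (1 / 2 :: real) ^ i"
        using zero_less_power[of "1 / 2 :: real" i] by linarith
      then have "zball Z z (4 * (1 / 2) ^ fst x) \<subseteq> zball Z z ((1 / 2) ^ i)"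
        unfolding zball_def by (intro Int_mono subset_ball order_refl)
      then show ?thesis
        using X'.level_ball_subset_zball[OF lev[OF x] zx] D(2) by blast
    qed
    then show ?thesis using near unfolding i_def by (intro conjI; linarith)
  qed
  then have "dominates X' e i D" using D lev by (auto simp: dominates_def)
  then show ?thesis by blast
qed

text \<open>
  The bookkeeping of scales in the telescoped estimate: dividing by the measure of a ball five
  levels below level \<open>i\<close> turns the measure of balls of level \<open>i + j\<close> into the weight \<open>t ^ j\<close>.
\<close>

lemma rescaled_power: fixes t :: real assumes "t > 0"
  shows "c / t ^ (i + 5) * (g * (c * w * t ^ (i + j))) = c\<^sup>2 * w / t ^ 5 * (t ^ j * g)"
  using assms by (simp add: power_add power2_eq_square field_simps)

text \<open>Both averages of \<open>f\<close> over the endpoints of \<open>e\<close> are compared with the average over \<open>D\<close>.\<close>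

lemma gradient_le_cross_edges:
  fixes f :: "'a \<Rightarrow> real"
  defines "t \<equiv> (1 / 2) powr Q" and "u \<equiv> poisson_ext M f"
  assumes X': "filled_space Z M Q c X'" and e: "e \<in> edges Z X'" and f: "integrable M f"
    and D: "dominates X' e i D"
  shows "\<bar>gradient X' u e\<bar> \<le> 2 * (c / t ^ (i + 5)) * mean_oscillation f (i + J) +
    2 * (c\<^sup>2 * 2 powr Q / t ^ 5) * (\<Sum>j<J. t ^ j * (\<Sum>a\<in>cross_edges Z X (i + j) D. \<bar>gradient X u a\<bar>))"
proof -
  interpret X': filled_space Z M Q c X' by (rule X')
  have t: "0 < t" "t \<le> 1" using Q_pos by (auto simp: t_def intro: powr_le1)
  define R where "R = mean_oscillation f (i + J) +
    (\<Sum>j<J. \<Sum>a\<in>cross_edges Z X (i + j) D. \<bar>gradient X u a\<bar> * (c * 2 powr Q * t ^ (i + j)))"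
  have half: "\<bar>u v - u (i, D)\<bar> \<le> c / t ^ (i + 5) * R" if v: "v \<in> e" for v
  proof -
    have v': "snd v \<in> level_balls Z X' (fst v)" "snd v \<subseteq> D" "fst v \<le> i + 5" "D \<in> level_balls Z X i"
      using D v by (auto simp: dominates_def)
    have "t ^ (i + 5) / c \<le> t ^ fst v / c"
      using v'(3) t c_ge_1 by (intro divide_right_mono power_decreasing) auto
    also have "\<dots> \<le> measure M (snd v)"
      unfolding t_def by (rule X'.measure_level_ball(1)[OF v'(1)])
    finally have "t ^ (i + 5) / c * \<bar>u v - u (i, D)\<bar> \<le> measure M (snd v) * \<bar>u v - u (i, D)\<bar>"
      by (intro mult_right_mono) auto
    also have "\<dots> \<le> R"
      using mean_minus_poisson_le[OF f v'(4) X'.sets_level_ball[OF v'(1)] v'(2)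
          X'.measure_level_ball_pos[OF v'(1)], of "fst v" J]
      by (simp add: R_def u_def t_def)
    finally show ?thesis using t c_ge_1 by (simp add: field_simps)
  qed
  obtain v w where vw: "e = {v, w}" using e by (auto simp: edges_def)
  have "\<bar>gradient X' u e\<bar> = \<bar>u v - u w\<bar>" by (rule X'.abs_gradient[OF e vw])
  also have "\<dots> \<le> 2 * (c / t ^ (i + 5) * R)" using half[of v] half[of w] vw by simp
  also have "c / t ^ (i + 5) * R = c / t ^ (i + 5) * mean_oscillation f (i + J) +
      (c\<^sup>2 * 2 powr Q / t ^ 5) * (\<Sum>j<J. t ^ j * (\<Sum>a\<in>cross_edges Z X (i + j) D. \<bar>gradient X u a\<bar>))"
    unfolding R_def distrib_left sum_distrib_left rescaled_power[OF t(1)] ..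
  finally show ?thesis by (simp add: algebra_simps)
qed

text \<open>
  The edge \<open>a\<close> determines its level, so \<open>a\<close> and \<open>j\<close> determine the level \<open>l\<close> of the dominating ball.
  All endpoints of the edges counted here therefore lie in one set \<open>W\<close> of vertices of \<open>X'\<close>, those
  of the levels \<open>l, \<dots>, l + 5\<close> close to a point \<open>y\<close> of \<open>a\<close>. As edges are sets of vertices, there
  are at most \<open>2 ^ card W\<close> of them.
\<close>

lemma card_dominated_edges:
  assumes X': "filled_space Z M Q c X'" and "finite F"
    and dom: "\<And>e. e \<in> F \<Longrightarrow> dominates X' e (i e) (D e)"
  shows "real (card {e \<in> F. a \<in> cross_edges Z X (i e + j) (D e)}) \<le> 2 powr (6 * (packing * (2 powr Q) ^ 5))"
proof (cases "{e \<in> F. a \<in> cross_edges Z X (i e + j) (D e)} = {}")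
  case True
  then show ?thesis by (simp only: card.empty) simp
next
  case False
  interpret X': filled_space Z M Q c X' by (rule X')
  obtain e0 where e0: "e0 \<in> F" "a \<in> cross_edges Z X (i e0 + j) (D e0)" using False by auto
  define l where "l = i e0"
  obtain B B' where a: "a = {(l + j, B), (Suc (l + j), B')}" and B: "B \<in> level_balls Z X (l + j)"
    using e0(2) by (auto simp: cross_edges_def l_def)
  obtain y where y: "y \<in> B" using level_ball_nonempty[OF B] by auto
  have yZ: "y \<in> Z" using y level_ball_subset_Z[OF B] by auto
  define A where "A m = {C \<in> level_balls Z X' m. C \<inter> zball Z y (8 * (1 / 2) ^ l) \<noteq> {}}" for m
  define W where "W = (SIGMA m:{l..l + 5}. A m)"
  have A: "finite (A m)" "real (card (A m)) \<le> packing * (2 powr Q) ^ 5" if m: "m \<in> {l..l + 5}" for m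
  proof -
    show "finite (A m)" unfolding A_def using X'.finite_level_balls by simp
    have "real (card (A m)) \<le> packing * (2 powr Q) ^ (m - l)"
      unfolding A_def using X'.card_level_balls_meeting(2)[OF yZ, of l m] m by simp
    also have "\<dots> \<le> packing * (2 powr Q) ^ 5"
      using m packing_pos Q_pos by (intro mult_left_mono power_increasing) (auto intro: ge_one_powr_ge_zero)
    finally show "real (card (A m)) \<le> packing * (2 powr Q) ^ 5" .
  qed
  have W: "finite W" "real (card W) \<le> 6 * (packing * (2 powr Q) ^ 5)"
  proof -
    show "finite W" unfolding W_def using A by blast
    have "real (card W) = (\<Sum>m\<in>{l..l + 5}. real (card (A m)))"
      unfolding W_def using A by (subst card_SigmaI) auto
    also have "\<dots> \<le> real (card {l..l + 5}) * (packing * (2 powr Q) ^ 5)"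
      by (intro sum_bounded_above A)
    finally show "real (card W) \<le> 6 * (packing * (2 powr Q) ^ 5)" by simp
  qed
  have "{e \<in> F. a \<in> cross_edges Z X (i e + j) (D e)} \<subseteq> Pow W"
  proof
    fix e assume "e \<in> {e \<in> F. a \<in> cross_edges Z X (i e + j) (D e)}"
    then have e: "e \<in> F" "a \<in> cross_edges Z X (i e + j) (D e)" by auto
    then obtain B1 B1' where a1: "a = {(i e + j, B1), (Suc (i e + j), B1')}"
      and meet: "B1 \<inter> D e \<noteq> {}"
      by (auto simp: cross_edges_def)
    have "i e + j = l + j \<and> B1 = B"
      using a a1 by (auto simp: doubleton_eq_iff)
    then have il: "i e = l" "B1 = B" by auto
    obtain x where x: "x \<in> B" "x \<in> D e" using meet il by auto
    have De: "D e \<in> level_balls Z X l" using dom[OF e(1)] il by (simp add: dominates_def)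
    have "dist y x < 4 * (1 / 2) ^ (l + j)"
      using level_ball_subset_zball[OF B y] x by (auto simp: zball_def)
    also have "\<dots> \<le> 4 * (1 / 2) ^ l" by (intro mult_left_mono power_decreasing) auto
    finally have yx: "dist y x < 4 * (1 / 2) ^ l" .
    have DZ: "D e \<subseteq> zball Z y (8 * (1 / 2) ^ l)"
    proof
      fix z assume "z \<in> D e"
      then have "z \<in> Z" "dist x z < 4 * (1 / 2) ^ l"
        using level_ball_subset_zball[OF De x(2)] by (auto simp: zball_def)
      then show "z \<in> zball Z y (8 * (1 / 2) ^ l)"
        using yx dist_triangle[of y z x] by (simp add: zball_def)
    qed
    have "v \<in> W" if v: "v \<in> e" for v
    proof -
      have v': "l \<le> fst v" "fst v \<le> l + 5" "snd v \<in> level_balls Z X' (fst v)" "snd v \<subseteq> D e"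
        using dom[OF e(1)] v il by (auto simp: dominates_def)
      then have "snd v \<inter> zball Z y (8 * (1 / 2) ^ l) \<noteq> {}"
        using X'.level_ball_nonempty DZ by blast
      then show ?thesis using v' by (cases v) (auto simp: W_def A_def)
    qed
    then show "e \<in> Pow W" by auto
  qed
  then have "card {e \<in> F. a \<in> cross_edges Z X (i e + j) (D e)} \<le> 2 ^ card W"
    using card_mono[of "Pow W"] W(1) by (simp add: card_Pow)
  then have "real (card {e \<in> F. a \<in> cross_edges Z X (i e + j) (D e)}) \<le> real (2 ^ card W)"
    by (rule of_nat_mono)
  also have "\<dots> = 2 powr real (card W)" by (simp add: powr_realpow)
  also have "\<dots> \<le> 2 powr (6 * (packing * (2 powr Q) ^ 5))" using W(2) by simp
  finally show ?thesis .
qed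

text \<open>
  The decisive gain: the union \<open>H\<close> of the edge sets has \<open>O(card F * (2 powr Q) ^ j)\<close> elements, and the
  hypothesis on \<open>s\<close> is applied to \<open>H\<close> at once, which costs only the power \<open>1 - 1/p\<close> of this number.
  The weight \<open>((1/2) powr Q) ^ j\<close> outweighs it by the factor \<open>((1/2) powr (Q/p)) ^ j\<close>.
\<close>

lemma sum_cross_edges_le:
  fixes s :: "'a edge \<Rightarrow> real"
  assumes X': "filled_space Z M Q c X'" and F: "finite F"
    and dom: "\<And>e. e \<in> F \<Longrightarrow> dominates X' e (i e) (D e)"
    and p: "p > 1" and b: "b \<ge> 0" "top_sum_bound p (edges Z X) s b"
  shows "((1 / 2) powr Q) ^ j * (\<Sum>e\<in>F. \<Sum>a\<in>cross_edges Z X (i e + j) (D e). \<bar>s a\<bar>) \<le>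
    2 powr (6 * (packing * (2 powr Q) ^ 5)) * (packing\<^sup>2 * 2 powr Q) powr (1 - 1 / p) * b
      * real (card F) powr (1 - 1 / p) * ((1 / 2) powr (Q / p)) ^ j"
proof -
  define N where "N = 2 powr (6 * (packing * (2 powr Q) ^ 5))"
  define G where "G e = cross_edges Z X (i e + j) (D e)" for e
  define H where "H = (\<Union>e\<in>F. G e)"
  have G: "finite (G e)" "real (card (G e)) \<le> packing\<^sup>2 * 2 powr Q * (2 powr Q) ^ j" if "e \<in> F" for e
    using cross_edges_of_ball[of "D e" "i e" "i e + j"] dom[OF that] by (auto simp: G_def dominates_def)
  have "finite H" using F G(1) by (simp add: H_def)
  have "H \<subseteq> edges Z X" using cross_edges_subset unfolding H_def G_def by blast
  note H = \<open>finite H\<close> this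
  have "real (card H) \<le> (\<Sum>e\<in>F. real (card (G e)))"
    using card_UN_le[OF F, of G] by (simp add: H_def flip: of_nat_sum)
  also have "\<dots> \<le> real (card F) * (packing\<^sup>2 * 2 powr Q * (2 powr Q) ^ j)"
    by (intro sum_bounded_above G)
  finally have card_H: "real (card H) \<le> real (card F) * (packing\<^sup>2 * 2 powr Q * (2 powr Q) ^ j)" .
  have "(\<Sum>e\<in>F. \<Sum>a\<in>G e. \<bar>s a\<bar>) = (\<Sum>e\<in>F. \<Sum>a\<in>H. if a \<in> G e then \<bar>s a\<bar> else 0)"
  proof (rule sum.cong[OF refl])
    fix e assume "e \<in> F"
    then have "H \<inter> {a. a \<in> G e} = G e" by (auto simp: H_def)
    then show "(\<Sum>a\<in>G e. \<bar>s a\<bar>) = (\<Sum>a\<in>H. if a \<in> G e then \<bar>s a\<bar> else 0)"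
      using H by (simp add: sum.If_cases)
  qed
  also have "\<dots> = (\<Sum>a\<in>H. \<Sum>e\<in>F. if a \<in> G e then \<bar>s a\<bar> else 0)" by (rule sum.swap)
  also have "\<dots> = (\<Sum>a\<in>H. real (card {e \<in> F. a \<in> G e}) * \<bar>s a\<bar>)"
    using F by (simp add: sum.If_cases Int_def)
  also have "\<dots> \<le> (\<Sum>a\<in>H. N * \<bar>s a\<bar>)"
    unfolding N_def G_def
    by (intro sum_mono mult_right_mono card_dominated_edges[OF X' F] dom) auto
  also have "\<dots> = N * (\<Sum>a\<in>H. \<bar>s a\<bar>)" by (simp add: sum_distrib_left)
  also have "\<dots> \<le> N * (b * real (card H) powr (1 - 1 / p))"
    using b H by (intro mult_left_mono) (auto simp: top_sum_bound_def N_def)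
  also have "\<dots> \<le> N * (b * (real (card F) * (packing\<^sup>2 * 2 powr Q * (2 powr Q) ^ j)) powr (1 - 1 / p))"
    using b p card_H by (intro mult_left_mono powr_mono2) (auto simp: N_def)
  also have "(real (card F) * (packing\<^sup>2 * 2 powr Q * (2 powr Q) ^ j)) powr (1 - 1 / p)
      = real (card F) powr (1 - 1 / p) * ((packing\<^sup>2 * 2 powr Q) powr (1 - 1 / p)
        * (((2 powr Q) powr (1 - 1 / p)) ^ j))"
    by (simp add: powr_mult power_powr_swap)
  finally have le: "(\<Sum>e\<in>F. \<Sum>a\<in>G e. \<bar>s a\<bar>) \<le> N * (b * (real (card F) powr (1 - 1 / p) *
      ((packing\<^sup>2 * 2 powr Q) powr (1 - 1 / p) * ((2 powr Q) powr (1 - 1 / p)) ^ j)))" .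
  have "(1 / 2) powr Q * (2 powr Q) powr (1 - 1 / p) = (1 / 2) powr (Q / p)"
    by (simp add: powr_powr powr_divide right_diff_distrib powr_diff)
  then have theta: "((1 / 2) powr Q) ^ j * ((2 powr Q) powr (1 - 1 / p)) ^ j = ((1 / 2) powr (Q / p)) ^ j"
    by (metis power_mult_distrib)
  have "((1 / 2) powr Q) ^ j * (\<Sum>e\<in>F. \<Sum>a\<in>G e. \<bar>s a\<bar>) \<le> ((1 / 2) powr Q) ^ j *
    (N * (b * (real (card F) powr (1 - 1 / p) *
      ((packing\<^sup>2 * 2 powr Q) powr (1 - 1 / p) * ((2 powr Q) powr (1 - 1 / p)) ^ j))))"
    by (rule mult_left_mono[OF le]) simp
  also have "\<dots> = N * (packing\<^sup>2 * 2 powr Q) powr (1 - 1 / p) * b * real (card F) powr (1 - 1 / p) *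
    (((1 / 2) powr Q) ^ j * ((2 powr Q) powr (1 - 1 / p)) ^ j)"
    by (simp only: mult_ac)
  finally show ?thesis unfolding theta by (simp add: N_def G_def)
qed

text \<open>
  The estimates are summed over \<open>F\<close> with chains of length \<open>J\<close>. The geometric series bounds the main
  term uniformly in \<open>J\<close>, and the mean oscillations disappear for \<open>J \<rightarrow> \<infinity>\<close>; they must be removed
  after fixing \<open>F\<close>, since their decay is not uniform in the edges.
\<close>

lemma top_sum_bound_other_filling:
  assumes X': "filled_space Z M Q c X'" and p: "p > 1"
  shows "\<exists>C\<ge>1. \<forall>f b. integrable M f \<longrightarrow> b \<ge> 0 \<longrightarrow>
    top_sum_bound p (edges Z X) (gradient X (poisson_ext M f)) b \<longrightarrow>
    top_sum_bound p (edges Z X') (gradient X' (poisson_ext M f)) (C * b)"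
proof -
  define t where "t = (1 / 2) powr Q"
  define q where "q = (1 / 2) powr (Q / p)"
  define C1 where "C1 = 2 * (c\<^sup>2 * 2 powr Q / t ^ 5)"
  define C2 where "C2 = 2 powr (6 * (packing * (2 powr Q) ^ 5)) * (packing\<^sup>2 * 2 powr Q) powr (1 - 1 / p)"
  have q: "0 < q" "q < 1"
    using Q_pos p powr_less_mono2[of "Q / p" "1 / 2" 1] by (auto simp: q_def)
  have C: "C1 > 0" "C2 > 0"
    using c_ge_1 packing_pos by (auto simp: C1_def C2_def t_def)
  define C where "C = C1 * C2 * (1 / (1 - q))"
  have C_bound: "top_sum_bound p (edges Z X') (gradient X' (poisson_ext M f)) (C * b)"
    if f: "integrable M f" and b: "b \<ge> 0" "top_sum_bound p (edges Z X) (gradient X (poisson_ext M f)) b"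
    for f b
    unfolding top_sum_bound_def
  proof (intro allI impI)
    fix F assume F: "F \<subseteq> edges Z X'" "finite F"
    let ?u = "poisson_ext M f"
    define n where "n = real (card F) powr (1 - 1 / p)"
    have "\<forall>e\<in>F. \<exists>i D. dominates X' e i D"
      using exists_dominating_ball[OF X'] F by blast
    then obtain i D where dom: "\<And>e. e \<in> F \<Longrightarrow> dominates X' e (i e) (D e)"
      by metis
    define E where "E J = (\<Sum>e\<in>F. 2 * (c / t ^ (i e + 5)) * mean_oscillation f (i e + J))" for J
    have "(\<lambda>J. E J) \<longlonglongrightarrow> (\<Sum>e\<in>F. 2 * (c / t ^ (i e + 5)) * 0)"
      unfolding E_def
    proof (intro tendsto_sum tendsto_mult tendsto_const)
      fix e
      show "(\<lambda>J. mean_oscillation f (i e + J)) \<longlonglongrightarrow> 0"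
        using LIMSEQ_ignore_initial_segment[OF mean_oscillation_tendsto_0[OF f], of "i e"]
        by (simp add: add.commute)
    qed
    then have lim: "(\<lambda>J. E J + C * b * n) \<longlonglongrightarrow> 0 + C * b * n"
      by (intro tendsto_add tendsto_const) simp
    have "(\<Sum>e\<in>F. \<bar>gradient X' ?u e\<bar>) \<le> E J + C * b * n" for J
    proof -
      define S where "S = (\<Sum>e\<in>F. \<Sum>j<J. t ^ j *
        (\<Sum>a\<in>cross_edges Z X (i e + j) (D e). \<bar>gradient X ?u a\<bar>))"
      have "S = (\<Sum>j<J. t ^ j * (\<Sum>e\<in>F. \<Sum>a\<in>cross_edges Z X (i e + j) (D e). \<bar>gradient X ?u a\<bar>))"
        unfolding S_def by (subst sum.swap) (simp only: sum_distrib_left)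
      also have "\<dots> \<le> (\<Sum>j<J. C2 * b * n * q ^ j)"
        unfolding t_def C2_def n_def q_def
        by (intro sum_mono sum_cross_edges_le[OF X' F(2) dom p b])
      also have "\<dots> = C2 * b * n * (\<Sum>j<J. q ^ j)" by (simp add: sum_distrib_left)
      also have "\<dots> \<le> C2 * b * n * (1 / (1 - q))"
        using q C b by (intro mult_left_mono) (auto simp: n_def sum_gp_strict field_simps)
      finally have S: "S \<le> C2 * b * n * (1 / (1 - q))" .
      have "(\<Sum>e\<in>F. \<bar>gradient X' ?u e\<bar>) \<le> (\<Sum>e\<in>F. 2 * (c / t ^ (i e + 5)) * mean_oscillation f (i e + J) +
          C1 * (\<Sum>j<J. t ^ j * (\<Sum>a\<in>cross_edges Z X (i e + j) (D e). \<bar>gradient X ?u a\<bar>)))"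
        unfolding C1_def t_def using F
        by (intro sum_mono gradient_le_cross_edges[OF X' _ f dom]) auto
      also have "\<dots> = E J + C1 * S"
        by (simp only: sum.distrib E_def S_def sum_distrib_left)
      also have "\<dots> \<le> E J + C1 * (C2 * b * n * (1 / (1 - q)))"
        using S C by (intro add_left_mono mult_left_mono) auto
      finally show ?thesis by (simp add: C_def mult_ac)
    qed
    then have "(\<Sum>e\<in>F. \<bar>gradient X' ?u e\<bar>) \<le> 0 + C * b * n"
      by (intro LIMSEQ_le_const[OF lim]) auto
    then show "(\<Sum>e\<in>F. \<bar>gradient X' ?u e\<bar>) \<le> C * b * real (card F) powr (1 - 1 / p)"
      by (simp add: n_def)
  qed
  have "top_sum_bound p (edges Z X') (gradient X' (poisson_ext M f)) (max 1 C * b)"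
    if "integrable M f" "b \<ge> 0" "top_sum_bound p (edges Z X) (gradient X (poisson_ext M f)) b" for f b
    unfolding top_sum_bound_def
  proof (intro allI impI)
    fix F assume F: "F \<subseteq> edges Z X'" "finite F"
    then have "(\<Sum>e\<in>F. \<bar>gradient X' (poisson_ext M f) e\<bar>) \<le> C * b * real (card F) powr (1 - 1 / p)"
      using C_bound[OF that] by (simp add: top_sum_bound_def)
    also have "\<dots> \<le> max 1 C * b * real (card F) powr (1 - 1 / p)"
      using that(2) by (intro mult_right_mono) auto
    finally show "(\<Sum>e\<in>F. \<bar>gradient X' (poisson_ext M f) e\<bar>)
        \<le> max 1 C * b * real (card F) powr (1 - 1 / p)" .
  qed
  then show ?thesis by (intro exI[of _ "max 1 C"]) auto
qed

lemma weak_lp_other_filling: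
  assumes X': "filled_space Z M Q c X'" and p: "p > 1"
  shows "\<exists>C\<ge>1. \<forall>f. integrable M f \<longrightarrow>
    (gradient X (poisson_ext M f) \<in> weak_lp p (edges Z X) \<longrightarrow>
      gradient X' (poisson_ext M f) \<in> weak_lp p (edges Z X')) \<and>
    A_seminorm p Z M X' f \<le> ennreal C * A_seminorm p Z M X f"
proof -
  obtain C where C: "C \<ge> 1" and bound: "\<And>f b. integrable M f \<Longrightarrow> b \<ge> 0 \<Longrightarrow>
      top_sum_bound p (edges Z X) (gradient X (poisson_ext M f)) b \<Longrightarrow>
      top_sum_bound p (edges Z X') (gradient X' (poisson_ext M f)) (C * b)"
    using top_sum_bound_other_filling[OF X' p] by blast
  have "(gradient X (poisson_ext M f) \<in> weak_lp p (edges Z X) \<longrightarrow>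
      gradient X' (poisson_ext M f) \<in> weak_lp p (edges Z X')) \<and>
    A_seminorm p Z M X' f \<le> ennreal C * A_seminorm p Z M X f" if f: "integrable M f" for f
  proof (cases "gradient X (poisson_ext M f) \<in> weak_lp p (edges Z X)")
    case True
    then obtain b where b: "b \<ge> 0" "A_seminorm p Z M X f = ennreal b"
      "top_sum_bound p (edges Z X) (gradient X (poisson_ext M f)) b"
      unfolding A_seminorm_def using top_sum_bound_weak_lp_norm[OF p] by blast
    have Cb: "C * b \<ge> 0" using C b by simp
    note b' = bound[OF f b(1,3)]
    have "A_seminorm p Z M X' f \<le> ennreal (C * b)"
      unfolding A_seminorm_def by (rule weak_lp_norm_le[OF p Cb b'])
    also have "\<dots> = ennreal C * A_seminorm p Z M X f"
      using C b by (simp add: ennreal_mult)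
    finally show ?thesis using top_sum_bound_imp_weak_lp[OF p Cb b'] by simp
  next
    case False
    then have "A_seminorm p Z M X f = top"
      by (simp add: A_seminorm_def weak_lp_norm_def)
    then show ?thesis using False C by (simp add: ennreal_mult_top)
  qed
  then show ?thesis using C by blast
qed

end

text \<open>
  Finitely many balls of radius \<open>1\<close> cover the compact space, so its measure is finite. The
  upper bound for radii above \<open>1\<close> then holds with the total measure as constant.
\<close>

lemma ahlfors_regular_imp_regular_space:
  assumes Q: "Q > 0" and Z: "compact Z" "diameter Z = 1" and reg: "ahlfors_regular Q Z M"
  shows "\<exists>c. regular_space Z M Q c"
proof -
  obtain c where c: "c \<ge> 1" and sets: "sets M = sets (restrict_space borel Z)"
    and lower: "\<And>z r. z \<in> Z \<Longrightarrow> 0 < r \<Longrightarrow> r \<le> 1 \<Longrightarrow> ennreal (inverse c * r powr Q) \<le> emeasure M (zball Z z r)"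
    and upper: "\<And>z r. z \<in> Z \<Longrightarrow> 0 < r \<Longrightarrow> r \<le> 1 \<Longrightarrow> emeasure M (zball Z z r) \<le> ennreal (c * r powr Q)"
    using reg unfolding ahlfors_regular_def by blast
  have space: "space M = Z"
    using sets_eq_imp_space_eq[OF sets] by (simp add: space_restrict_space)
  have zball: "zball Z z r \<in> sets M" for z r
    by (auto simp: sets sets_restrict_space zball_def)
  obtain A where A: "finite A" "A \<subseteq> Z" "Z \<subseteq> (\<Union>z\<in>A. ball z 1)"
    using compactE_image[OF Z(1), of Z "\<lambda>z. ball z 1"] by force
  have "Z = (\<Union>z\<in>A. zball Z z 1)" using A by (auto simp: zball_def)
  then have "emeasure M Z = emeasure M (\<Union>z\<in>A. zball Z z 1)" by simp
  also have "\<dots> \<le> (\<Sum>z\<in>A. emeasure M (zball Z z 1))"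
    using A zball by (intro emeasure_subadditive_finite) auto
  also have "\<dots> < \<infinity>"
    using A upper[of _ 1] by (auto simp: ennreal_less_top intro!: le_less_trans[OF upper])
  finally have fin: "finite_measure M"
    by (intro finite_measureI) (simp add: space)
  then interpret finite_measure M .
  define C where "C = max c (measure M Z)"
  have "regular_space Z M Q C"
  proof
    show "Q > 0" "compact Z" "sets M = sets (restrict_space borel Z)" by fact+
    show "Z \<noteq> {}" using Z(2) by auto
    show "dist x y \<le> 1" if "x \<in> Z" "y \<in> Z" for x y
      using diameter_bounded_bound[OF compact_imp_bounded[OF Z(1)] that] Z(2) by simp
    show "C \<ge> 1" using c by (simp add: C_def)
    show "r powr Q / C \<le> measure M (zball Z z r)" if "z \<in> Z" "0 < r" "r \<le> 1" for z r
    proof -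
      have "r powr Q / C \<le> r powr Q / c" using c by (intro divide_left_mono) (auto simp: C_def)
      also have "\<dots> \<le> measure M (zball Z z r)"
        using lower[OF that] c by (simp add: emeasure_eq_measure divide_inverse mult.commute)
      finally show ?thesis .
    qed
    show "measure M (zball Z z r) \<le> C * r powr Q" if z: "z \<in> Z" "0 < r" for z r
    proof (cases "r \<le> 1")
      case True
      have "measure M (zball Z z r) \<le> c * r powr Q"
        using upper[OF z True] c by (simp add: emeasure_eq_measure)
      also have "\<dots> \<le> C * r powr Q" by (intro mult_right_mono) (auto simp: C_def)
      finally show ?thesis .
    next
      case False
      have "measure M (zball Z z r) \<le> measure M Z"
        using sets.top[of M] by (intro finite_measure_mono) (auto simp: zball_def space)
      also have "\<dots> \<le> C * 1" by (simp add: C_def)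
      also have "\<dots> \<le> C * r powr Q"
        using False Q c by (intro mult_left_mono ge_one_powr_ge_zero) (auto simp: C_def)
      finally show ?thesis .
    qed
  qed
  then show ?thesis by blast
qed

theorem corollary4p6:
  fixes Z :: "'a::metric_space set" and M :: "'a measure" and Q p :: real
    and X X' :: "'a filling"
  assumes "Q > 0"
    and "compact Z"
    and "diameter Z = 1"
    and "ahlfors_regular Q Z M"
    and "p > 1"
    and "hyperbolic_filling Z X"
    and "hyperbolic_filling Z X'"
  shows "A_space p Z M X = A_space p Z M X' \<and>
    (\<exists>C::real. C \<ge> 1 \<and> (\<forall>f :: 'a \<Rightarrow> real. integrable M f \<longrightarrow>
       (gradient X (poisson_ext M f) \<in> weak_lp p (edges Z X) \<longleftrightarrow>
        gradient X' (poisson_ext M f) \<in> weak_lp p (edges Z X')) \<and>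
       ennreal (inverse C) * A_seminorm p Z M X f \<le> A_seminorm p Z M X' f \<and>
       A_seminorm p Z M X' f \<le> ennreal C * A_seminorm p Z M X f))"
proof -
  obtain c where "regular_space Z M Q c" using ahlfors_regular_imp_regular_space assms(1-4) by blast
  then interpret regular_space Z M Q c .
  interpret X: filled_space Z M Q c X by unfold_locales (rule assms)
  interpret X': filled_space Z M Q c X' by unfold_locales (rule assms)
  obtain C1 where C1: "C1 \<ge> 1" "\<And>f. integrable M f \<Longrightarrow>
      gradient X (poisson_ext M f) \<in> weak_lp p (edges Z X) \<Longrightarrow>
      gradient X' (poisson_ext M f) \<in> weak_lp p (edges Z X')"
    "\<And>f. integrable M f \<Longrightarrow> A_seminorm p Z M X' f \<le> ennreal C1 * A_seminorm p Z M X f"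
    using X.weak_lp_other_filling[OF X'.filled_space_axioms assms(5)] by blast
  obtain C2 where C2: "C2 \<ge> 1" "\<And>f. integrable M f \<Longrightarrow>
      gradient X' (poisson_ext M f) \<in> weak_lp p (edges Z X') \<Longrightarrow>
      gradient X (poisson_ext M f) \<in> weak_lp p (edges Z X)"
    "\<And>f. integrable M f \<Longrightarrow> A_seminorm p Z M X f \<le> ennreal C2 * A_seminorm p Z M X' f"
    using X'.weak_lp_other_filling[OF X.filled_space_axioms assms(5)] by blast
  define C where "C = max C1 C2"
  have C: "C \<ge> 1" using C1(1) by (simp add: C_def)
  have le1: "A_seminorm p Z M X' f \<le> ennreal C * A_seminorm p Z M X f" if "integrable M f" for f
    by (rule order_trans[OF C1(3)[OF that] mult_right_mono]) (auto simp: C_def intro: ennreal_leI)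
  have le2: "ennreal (inverse C) * A_seminorm p Z M X f \<le> A_seminorm p Z M X' f"
    if "integrable M f" for f
  proof -
    have "A_seminorm p Z M X f \<le> ennreal C * A_seminorm p Z M X' f"
      by (rule order_trans[OF C2(3)[OF that] mult_right_mono]) (auto simp: C_def intro: ennreal_leI)
    then have "ennreal (inverse C) * A_seminorm p Z M X f
        \<le> ennreal (inverse C) * (ennreal C * A_seminorm p Z M X' f)"
      by (intro mult_left_mono) auto
    also have "\<dots> = ennreal (inverse C * C) * A_seminorm p Z M X' f"
      using C unfolding mult.assoc[symmetric] by (subst ennreal_mult) auto
    also have "\<dots> = A_seminorm p Z M X' f" using C by simp
    finally show ?thesis .
  qed
  have "A_space p Z M X = A_space p Z M X'"
    using C1(2) C2(2) by (auto simp: A_space_def)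
  moreover have "\<forall>f. integrable M f \<longrightarrow>
       (gradient X (poisson_ext M f) \<in> weak_lp p (edges Z X) \<longleftrightarrow>
        gradient X' (poisson_ext M f) \<in> weak_lp p (edges Z X')) \<and>
       ennreal (inverse C) * A_seminorm p Z M X f \<le> A_seminorm p Z M X' f \<and>
       A_seminorm p Z M X' f \<le> ennreal C * A_seminorm p Z M X f"
    using C1(2) C2(2) le1 le2 by blast
  ultimately show ?thesis using C by blast
qed

end
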